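(* Let $\{\Theta(k)\}_{k=0}^\infty$ be a bounded sequence of arbitrary real or complex numbers, and put $\sigma=\dfrac{2\mu+2\nu+3}{2\xi}$. Then, when $\xi>0$ and $\Re(b)>0$, we have $$\sum_{k=0}^\infty\frac{\Theta(k)}{k!}\int_0^\infty x^\mu e^{-(b+ck)x^\xi}\sqrt{xy}\,J_\nu(xy)\,dx=\frac{y^{\nu+1/2}}{2^\nu b^\sigma\xi}\sum_{k=0}^\infty\frac{\Theta(k)}{k!}\left(\frac{(b/c)_k}{(1+b/c)_k}\right)^\sigma{}_1\Psi_1\left[\begin{array}{c}(\sigma,2/\xi)\\(\nu+1,1)\end{array}\Big|\,-\frac{y^2}{4(b+ck)^{2/\xi}}\right].$$
   Context: $J_\nu$ is the Bessel function of the first kind, $J_\nu(z)=(z/2)^\nu\sum_{k=0}^\infty\frac{(-1)^k(z/2)^{2k}}{k!\,\Gamma(\nu+1+k)}$. $(a)_k=\Gamma(a+k)/\Gamma(a)$ is the Pochhammer symbol. The Fox–Wright function is $${}_p\Psi_q\left[\begin{array}{c}(\alpha_1,A_1),\ldots,(\alpha_p,A_p)\\(\beta_1,B_1),\ldots,(\beta_q,B_q)\end{array}\Big|\,z\right]=\sum_{k=0}^\infty\frac{\Gamma(\alpha_1+kA_1)\cdots\Gamma(\alpha_p+kA_p)}{\Gamma(\beta_1+kB_1)\cdots\Gamma(\beta_q+kB_q)}\,\frac{z^k}{k!},$$ where $z,\alpha_j,\beta_j\in\mathbb{C}$ and $A_j,B_j\ge0$, it being supposed throughout that the parameters are such that the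 gamma functions are well defined. In particular $${}_1\Psi_1\left[\begin{array}{c}(\sigma,2/\xi)\\(\nu+1,1)\end{array}\Big|\,z\right]=\sum_{\ell=0}^\infty\frac{\Gamma(\sigma+2\ell/\xi)}{\Gamma(\nu+1+\ell)}\frac{z^\ell}{\ell!}.$$
   Formalization: Conditions left implicit are added so that both sides exist: y>0, c≠0, Re(c)≥0, Re(μ+ν)>−3/2, ν+1 not a nonpositive integer, and convergence of each ₁Ψ₁ series on the right (this excludes 0<ξ<1, where it diverges, and restricts y when ξ=1). *)

theory Defs
  imports "HOL-Analysis.Analysis"
begin

definition bessel_J :: "complex \<Rightarrow> complex \<Rightarrow> complex" where
  "bessel_J \<nu> z = (z / 2) powr \<nu> *
     (\<Sum>k. (-1) ^ k * (z / 2) ^ (2 * k) / (fact k * Gamma (\<nu> + 1 + of_nat k)))"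

text \<open>
  The parameter lists hold the pairs \<open>(\<alpha>\<^sub>j, A\<^sub>j)\<close> and \<open>(\<beta>\<^sub>j, B\<^sub>j)\<close>, the second components being
  meant to be nonnegative.  Since \<open>suminf\<close> is total, the value \<open>fox_wright as bs z\<close> is
  meaningful only if \<open>summable (fox_wright_term as bs z)\<close> holds and no Gamma function is
  evaluated at a pole.  For \<open>as = [(\<sigma>, 2 / \<xi>)]\<close> and \<open>bs = [(\<nu> + 1, 1)]\<close> the series converges for
  every \<open>z\<close> if \<open>\<xi> > 1\<close>, has radius of convergence \<open>1 / 4\<close> if \<open>\<xi> = 1\<close>, and diverges for every
  \<open>z \<noteq> 0\<close> if \<open>0 < \<xi> < 1\<close>.
\<close>

definition fox_wright_term ::
    "(complex \<times> real) list \<Rightarrow> (complex \<times> real) list \<Rightarrow> complex \<Rightarrow> nat \<Rightarrow> complex" where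
  "fox_wright_term as bs z k =
     (\<Prod>(\<alpha>, A)\<leftarrow>as. Gamma (\<alpha> + of_nat k * of_real A)) /
     (\<Prod>(\<beta>, B)\<leftarrow>bs. Gamma (\<beta> + of_nat k * of_real B)) * (z ^ k / fact k)"

definition fox_wright ::
    "(complex \<times> real) list \<Rightarrow> (complex \<times> real) list \<Rightarrow> complex \<Rightarrow> complex" where
  "fox_wright as bs z = (\<Sum>k. fox_wright_term as bs z k)"

end

theory Submission
  imports Defs "HOL-Complex_Analysis.Conformal_Mappings"
begin

text \<open>
  Everything reduces to a single integral with \<open>a = b + c k\<close> in the right half-plane. Put
  \<open>s = \<mu> + \<nu> + 3 / 2\<close>, so that \<open>\<sigma> = s / \<xi>\<close> and \<open>Re s > 0\<close>. Up to the factor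
  \<open>y powr (\<nu> + 1 / 2) / 2 powr \<nu>\<close>, the integral is the Laplace-type integral \<open>hankel_Laplace s \<nu> y \<xi> a\<close>
  of \<open>x powr (s - 1) * C\<^sub>\<nu>(- (x y)\<^sup>2 / 4)\<close> against \<open>exp (- a x powr \<xi>)\<close>, where \<open>C\<^sub>\<nu>\<close> is the entire part
  of the Bessel function (the Bessel--Clifford function). The heart of the matter is
  \<open>hankel_Laplace_eq_fox_wright\<close>: whenever the series on the right converges, this integral equals
  \<open>a powr (- \<sigma>) / \<xi>\<close> times the Fox--Wright value at \<open>- y\<^sup>2 / (4 a powr (2 / \<xi>))\<close>.

  Expanding \<open>C\<^sub>\<nu>\<close> and integrating term by term gives this formally, each term being a Gamma
  integral. For \<open>\<xi> = 1\<close>, however, absolute convergence of the expanded integral demands roughly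
  \<open>Re a > y\<close>, while the series already converges for \<open>\<bar>a\<bar> > y\<close> and possibly on \<open>\<bar>a\<bar> = y\<close>. The identity
  is therefore first proved for large real \<open>a\<close> (\<open>hankel_Laplace_real_sums\<close>) and then continued
  analytically to all admissible \<open>a\<close> with convergence in a neighbourhood. The boundary of that
  region is reached by Abel's limit theorem (\<open>Abel_limit\<close>) on the series side and by continuity on
  the integral side. For \<open>\<xi> < 1\<close> the series diverges off the origin
  (\<open>not_summable_fox_wright_term\<close>), so the assumed convergence rules this case out.

  Continuation needs the integral to exist and be holomorphic on the whole half-plane \<open>Re a > 0\<close>.
  The power series of \<open>C\<^sub>\<nu>\<close> only yields exponential growth, which is not enough for \<open>\<xi> = 1\<close>; the
  differential equation gives polynomial growth along the negative axis instead
  (\<open>bessel_clifford_polynomial_bound\<close>).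

  Finally, \<open>(b / c)\<^sub>k / (1 + b / c)\<^sub>k\<close> is \<open>b / (b + c k)\<close>, and principal powers split over this quotient because
  both numbers lie in the right half-plane. Since \<open>Re (b + c k) \<ge> Re b\<close>, the integrals are bounded
  uniformly in \<open>k\<close>, so that the factors \<open>1 / k!\<close> make both series converge.
\<close>

section \<open>The Bessel--Clifford function\<close>

text \<open>
  The entire function \<open>C\<^sub>\<nu>\<close> with \<open>J\<^sub>\<nu>(z) = (z / 2)\<^sup>\<nu> C\<^sub>\<nu>(- z\<^sup>2 / 4)\<close>. Using \<open>rGamma\<close> in place of a quotient by
  \<open>Gamma\<close> makes its recurrence and derivative formula valid for every \<open>\<nu>\<close>.
\<close>

definition bessel_clifford :: "complex \<Rightarrow> complex \<Rightarrow> complex" where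
  "bessel_clifford \<nu> w = (\<Sum>k. rGamma (\<nu> + 1 + of_nat k) / fact k * w ^ k)"

lemma one_plus_of_nat_neq_0 [simp]: "1 + of_nat k \<noteq> (0 :: complex)"
  by (metis of_nat_Suc of_nat_eq_0_iff nat.distinct(1))

text \<open>
  The factor \<open>2 ^ k\<close> leaves room for the recurrence \<open>rGamma z = z * rGamma (z + 1)\<close>: as soon as
  \<open>k \<ge> 2 \<bar>s\<bar> + 1\<close>, one has \<open>\<bar>s + k\<bar> \<ge> (k + 1) / 2\<close>, so \<open>\<bar>rGamma (s + k)\<bar> * k! / 2 ^ k\<close> decreases from there on.
\<close>

lemma norm_rGamma_shift_le:
  fixes s :: complex
  obtains C where "C \<ge> 0" "\<And>k. norm (rGamma (s + of_nat k)) \<le> C * 2 ^ k / fact k"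
proof -
  define f where "f = (\<lambda>k. norm (rGamma (s + of_nat k)) * fact k / 2 ^ k)"
  define N where "N = nat \<lceil>2 * norm s + 1\<rceil>"
  have f_nonneg: "f k \<ge> 0" for k by (simp add: f_def)
  have step: "f (Suc k) \<le> f k" if "k \<ge> N" for k
  proof -
    have k: "real k \<ge> 2 * norm s + 1"
      using that unfolding N_def by linarith
    have "real k \<le> norm (s + of_nat k) + norm s"
      using norm_triangle_ineq4[of "s + of_nat k" s] by simp
    with k have le: "real (Suc k) \<le> 2 * norm (s + of_nat k)" by simp
    have "rGamma (s + of_nat k) = (s + of_nat k) * rGamma (s + of_nat (Suc k))"
      by (subst rGamma_plus1[symmetric]) (simp add: add_ac)
    hence "f k = norm (s + of_nat k) * norm (rGamma (s + of_nat (Suc k))) * fact k / 2 ^ k"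
      by (simp add: f_def norm_mult)
    moreover have "f (Suc k) = real (Suc k) / 2 * norm (rGamma (s + of_nat (Suc k))) * fact k / 2 ^ k"
      by (simp add: f_def)
    moreover have "real (Suc k) / 2 \<le> norm (s + of_nat k)" using le by simp
    ultimately show ?thesis
      by (simp only:) (intro divide_right_mono mult_right_mono, auto)
  qed
  have tail: "f k \<le> f N" if "k \<ge> N" for k
    using that by (induction k rule: dec_induct) (auto intro: order_trans[OF step])
  have "f k \<le> (\<Sum>j\<le>N. f j)" for k
  proof (cases "k \<le> N")
    case True
    thus ?thesis by (intro member_le_sum) (auto simp: f_nonneg)
  next
    case False
    hence "f k \<le> f N" by (intro tail) auto
    also have "f N \<le> (\<Sum>j\<le>N. f j)" by (intro member_le_sum) (auto simp: f_nonneg)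
    finally show ?thesis .
  qed
  hence "norm (rGamma (s + of_nat k)) \<le> (\<Sum>j\<le>N. f j) * 2 ^ k / fact k" for k
    by (simp add: f_def field_simps)
  thus ?thesis by (intro that[of "\<Sum>j\<le>N. f j"]) (auto intro!: sum_nonneg f_nonneg)
qed

lemma summable_bessel_clifford_term:
  fixes s w :: complex
  shows "summable (\<lambda>k. rGamma (s + of_nat k) / fact k * w ^ k)"
proof -
  obtain C where C: "C \<ge> 0" "\<And>k. norm (rGamma (s + of_nat k)) \<le> C * 2 ^ k / fact k"
    using norm_rGamma_shift_le by blast
  have "summable (\<lambda>k. C * (inverse (fact k) * (2 * norm w) ^ k))"
    by (intro summable_mult summable_exp)
  moreover have "norm (rGamma (s + of_nat k) / fact k * w ^ k)
       \<le> C * (inverse (fact k) * (2 * norm w) ^ k)" for k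
  proof -
    have "norm (rGamma (s + of_nat k) / fact k * w ^ k)
        = norm (rGamma (s + of_nat k)) * (norm w ^ k / fact k)"
      by (simp add: norm_mult norm_divide norm_power)
    also have "\<dots> \<le> (C * 2 ^ k / fact k) * (norm w ^ k / fact k)"
      by (intro mult_right_mono C) auto
    also have "\<dots> \<le> (C * 2 ^ k / 1) * (norm w ^ k / fact k)"
      by (intro mult_right_mono divide_left_mono) (auto simp: C fact_ge_1)
    also have "\<dots> = C * (inverse (fact k) * (2 * norm w) ^ k)"
      by (simp add: power_mult_distrib divide_inverse)
    finally show ?thesis .
  qed
  ultimately show ?thesis by (rule summable_comparison_test'[where N = 0])
qed

lemma bessel_clifford_sums:
  "(\<lambda>k. rGamma (\<nu> + 1 + of_nat k) / fact k * w ^ k) sums bessel_clifford \<nu> w"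
  unfolding bessel_clifford_def using summable_bessel_clifford_term by (rule summable_sums)

lemma has_field_derivative_bessel_clifford:
  "(bessel_clifford \<nu> has_field_derivative bessel_clifford (\<nu> + 1) w) (at w)"
proof -
  let ?c = "\<lambda>k. rGamma (\<nu> + 1 + of_nat k) / fact k"
  have "((\<lambda>w. \<Sum>k. ?c k * w ^ k) has_field_derivative (\<Sum>k. diffs ?c k * w ^ k)) (at w)"
    by (rule termdiffs_strong_converges_everywhere) (rule summable_bessel_clifford_term)
  moreover have "diffs ?c = (\<lambda>k. rGamma ((\<nu> + 1) + 1 + of_nat k) / fact k)"
    by (auto simp: diffs_def fun_eq_iff add_ac divide_simps)
  ultimately show ?thesis by (simp add: bessel_clifford_def [abs_def])
qed

text \<open>
  Together with the derivative formula, this is the differential equation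
  \<open>w C\<^sub>\<nu>'' + (\<nu> + 1) C\<^sub>\<nu>' = C\<^sub>\<nu>\<close>.
\<close>

lemma bessel_clifford_contiguous:
  "bessel_clifford \<nu> w = (\<nu> + 1) * bessel_clifford (\<nu> + 1) w + w * bessel_clifford (\<nu> + 2) w"
proof -
  let ?t = "\<lambda>k. of_nat k * rGamma (\<nu> + 2 + of_nat k) / fact k * w ^ k"
  have shift: "?t (Suc k) = w * (rGamma ((\<nu> + 2) + 1 + of_nat k) / fact k * w ^ k)" for k
    by (simp add: add_ac divide_simps)
  have "(\<lambda>k. ?t (Suc k)) sums (w * bessel_clifford (\<nu> + 2) w)"
    unfolding shift by (intro sums_mult bessel_clifford_sums)
  hence "?t sums (w * bessel_clifford (\<nu> + 2) w)"
    by (subst (asm) sums_Suc_iff) simp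
  hence "(\<lambda>k. (\<nu> + 1) * (rGamma ((\<nu> + 1) + 1 + of_nat k) / fact k * w ^ k) + ?t k)
      sums ((\<nu> + 1) * bessel_clifford (\<nu> + 1) w + w * bessel_clifford (\<nu> + 2) w)"
    by (intro sums_add sums_mult bessel_clifford_sums)
  moreover have "(\<nu> + 1) * (rGamma ((\<nu> + 1) + 1 + of_nat k) / fact k * w ^ k) + ?t k
     = rGamma (\<nu> + 1 + of_nat k) / fact k * w ^ k" for k
  proof -
    have "rGamma (\<nu> + 1 + of_nat k) = (\<nu> + 1 + of_nat k) * rGamma (\<nu> + 2 + of_nat k)"
      by (subst rGamma_plus1[symmetric]) (simp add: add_ac)
    moreover have "\<nu> + 1 + 1 + of_nat k = \<nu> + 2 + of_nat k" by simp
    ultimately show ?thesis by (simp only: add_divide_distrib distrib_right mult.assoc times_divide_eq_left times_divide_eq_right)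
  qed
  ultimately show ?thesis using bessel_clifford_sums[of \<nu> w] sums_unique2 by simp
qed

text \<open>
  An energy argument. Along \<open>w = - x\<^sup>2 / 4\<close> let \<open>P\<close> and \<open>Q\<close> be the values of \<open>C\<^sub>\<nu>\<close> and its derivative. The
  energy \<open>E = \<bar>P\<bar>\<^sup>2 + x\<^sup>2 / 4 * \<bar>Q\<bar>\<^sup>2\<close> is the sum of the squared moduli of \<open>P\<close> and \<open>dP/dx\<close>, and the
  differential equation bounds \<open>E'\<close> by \<open>M E / x\<close>. Hence \<open>E\<close> grows at most like \<open>x powr M\<close>. No sharp
  exponent is sought, since the bound is only ever compared with \<open>exp (- e x powr \<xi>)\<close>.
\<close>

lemma bessel_clifford_polynomial_bound:
  obtains C M where "C \<ge> 0" "M \<ge> 0"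
    "\<And>x::real. x \<ge> 0 \<Longrightarrow> norm (bessel_clifford \<nu> (- (of_real x ^ 2 / 4))) \<le> C * (1 + x powr M)"
proof -
  define P where "P = (\<lambda>x::real. bessel_clifford \<nu> (- (of_real x ^ 2 / 4)))"
  define Q where "Q = (\<lambda>x::real. bessel_clifford (\<nu> + 1) (- (of_real x ^ 2 / 4)))"
  define R where "R = (\<lambda>x::real. bessel_clifford (\<nu> + 2) (- (of_real x ^ 2 / 4)))"
  define E where "E = (\<lambda>x. P x \<bullet> P x + x ^ 2 / 4 * (Q x \<bullet> Q x))"
  define M where "M = 2 * \<bar>2 * Re \<nu> + 1\<bar>"
  have w: "((\<lambda>x. - (complex_of_real x ^ 2 / 4)) has_vector_derivative - (of_real x / 2)) (at x)" for x
    by (rule has_vector_derivative_real_field) (auto intro!: derivative_eq_intros)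
  have P': "(P has_vector_derivative - (of_real x / 2) * Q x) (at x)" for x
    using field_vector_diff_chain_at[OF w has_field_derivative_bessel_clifford[of \<nu>]]
    by (simp add: P_def Q_def o_def)
  have Q': "(Q has_vector_derivative - (of_real x / 2) * R x) (at x)" for x
    using field_vector_diff_chain_at[OF w has_field_derivative_bessel_clifford[of "\<nu> + 1"]]
    by (simp add: Q_def R_def o_def add_ac)
  have PQR: "P x = (\<nu> + 1) * Q x - of_real x ^ 2 / 4 * R x" for x
    unfolding P_def Q_def R_def by (subst bessel_clifford_contiguous) simp
  (* The differential equation makes the mixed terms of the energy cancel. *)
  have E': "(E has_real_derivative - (2 * Re \<nu> + 1) * x / 2 * (Q x \<bullet> Q x)) (at x)" for x
  proof -
    have "(E has_vector_derivative
        (P x \<bullet> (- (of_real x / 2) * Q x) + (- (of_real x / 2) * Q x) \<bullet> P x)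
        + (x ^ 2 / 4 * (Q x \<bullet> (- (of_real x / 2) * R x) + (- (of_real x / 2) * R x) \<bullet> Q x)
           + (x / 2) * (Q x \<bullet> Q x))) (at x)"
      unfolding E_def
      by (intro has_vector_derivative_add
           has_vector_derivative_mult
           bounded_bilinear.has_vector_derivative[OF bounded_bilinear_inner] P' Q')
         (auto intro!: derivative_eq_intros simp: has_real_derivative_iff_has_vector_derivative[symmetric])
    moreover have "(P x \<bullet> (- (of_real x / 2) * Q x) + (- (of_real x / 2) * Q x) \<bullet> P x)
        + (x ^ 2 / 4 * (Q x \<bullet> (- (of_real x / 2) * R x) + (- (of_real x / 2) * R x) \<bullet> Q x)
           + (x / 2) * (Q x \<bullet> Q x)) = - (2 * Re \<nu> + 1) * x / 2 * (Q x \<bullet> Q x)"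
      unfolding PQR by (simp add: inner_complex_def power2_eq_square) algebra
    ultimately show ?thesis by (simp only: has_real_derivative_iff_has_vector_derivative)
  qed
  have E_nonneg: "E x \<ge> 0" for x by (simp add: E_def)
  have decr: "E x * x powr (-M) \<le> E 1 * 1 powr (-M)" if "x \<ge> 1" for x
  proof (rule DERIV_nonpos_imp_nonincreasing[OF that])
    fix t :: real assume t: "1 \<le> t" "t \<le> x"
    have "((\<lambda>x. E x * x powr (-M)) has_real_derivative
        (- (2 * Re \<nu> + 1) * t / 2 * (Q t \<bullet> Q t)) * t powr (-M) + (-M * t powr (-M - 1)) * E t) (at t)"
      by (rule DERIV_mult[OF E']) (use t in \<open>auto intro!: derivative_eq_intros\<close>)
    moreover have "(- (2 * Re \<nu> + 1) * t / 2 * (Q t \<bullet> Q t)) * t powr (-M) + (-M * t powr (-M - 1)) * E t \<le> 0"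
    proof -
      have eq: "t powr (-M) = t * t powr (-M - 1)"
        using t by (simp add: powr_mult_base)
      have "- (2 * Re \<nu> + 1) * t / 2 * (Q t \<bullet> Q t) * t \<le> \<bar>2 * Re \<nu> + 1\<bar> * t / 2 * (Q t \<bullet> Q t) * t"
        using t by (intro mult_right_mono divide_right_mono) auto
      also have "\<dots> = M * (t ^ 2 / 4 * (Q t \<bullet> Q t))" by (simp add: M_def power2_eq_square)
      also have "\<dots> \<le> M * E t" by (intro mult_left_mono) (auto simp: E_def M_def)
      finally have "(- (2 * Re \<nu> + 1) * t / 2 * (Q t \<bullet> Q t) * t - M * E t) * t powr (-M - 1) \<le> 0"
        by (intro mult_nonpos_nonneg) auto
      thus ?thesis unfolding eq by (simp add: algebra_simps)
    qed
    ultimately show "\<exists>y. ((\<lambda>x. E x * x powr (-M)) has_real_derivative y) (at t) \<and> y \<le> 0" by blast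
  qed
  have far: "norm (P x) \<le> sqrt (E 1) * x powr (M / 2)" if "x \<ge> 1" for x
  proof -
    have "(norm (P x)) ^ 2 \<le> E x" by (simp add: E_def power2_norm_eq_inner)
    also have "E x \<le> E 1 * x powr M"
      using decr[OF that] that by (simp add: powr_minus field_simps)
    finally have "norm (P x) \<le> sqrt (E 1 * x powr M)" by (rule real_le_rsqrt)
    thus ?thesis by (simp add: real_sqrt_mult powr_half_sqrt[symmetric] powr_powr)
  qed
  have "continuous_on {0..1} P"
    by (intro continuous_at_imp_continuous_on ballI has_vector_derivative_continuous[OF P'])
  hence "bounded (P ` {0..1})"
    by (intro compact_imp_bounded compact_continuous_image) auto
  then obtain B where B: "\<And>x. x \<in> {0..1} \<Longrightarrow> norm (P x) \<le> B"
    unfolding bounded_iff by blast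
  have B0: "B \<ge> 0" by (rule order_trans[OF norm_ge_zero B[of 0]]) simp
  show ?thesis
  proof (rule that[of "B + sqrt (E 1)" "M / 2"])
    fix x :: real assume x: "x \<ge> 0"
    show "norm (bessel_clifford \<nu> (- (of_real x ^ 2 / 4))) \<le> (B + sqrt (E 1)) * (1 + x powr (M / 2))"
    proof (cases "x \<le> 1")
      case True
      hence "norm (P x) \<le> B * 1" using x B by simp
      also have "\<dots> \<le> (B + sqrt (E 1)) * (1 + x powr (M / 2))"
        by (intro mult_mono) (auto simp: B0 E_nonneg)
      finally show ?thesis by (simp add: P_def)
    next
      case False
      hence "norm (P x) \<le> sqrt (E 1) * x powr (M / 2)" by (intro far) auto
      also have "\<dots> \<le> (B + sqrt (E 1)) * (1 + x powr (M / 2))"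
        by (intro mult_mono) (auto simp: B0 E_nonneg)
      finally show ?thesis by (simp add: P_def)
    qed
  qed (auto simp: B0 E_nonneg M_def)
qed

lemma bessel_J_eq_bessel_clifford:
  "bessel_J \<nu> z = (z / 2) powr \<nu> * bessel_clifford \<nu> (- (z ^ 2 / 4))"
proof -
  have "(-1) ^ k * (z / 2) ^ (2 * k) / (fact k * Gamma (\<nu> + 1 + of_nat k)) =
      rGamma (\<nu> + 1 + of_nat k) / fact k * (- (z ^ 2 / 4)) ^ k" for k
  proof -
    have "- (z ^ 2 / 4) = (-1) * (z / 2) ^ 2" by (simp add: power_divide)
    hence w: "(- (z ^ 2 / 4)) ^ k = (-1) ^ k * (z / 2) ^ (2 * k)"
      by (simp only: power_mult_distrib power_mult)
    show ?thesis
      unfolding w by (simp only: rGamma_inverse_Gamma divide_inverse inverse_mult_distrib mult_ac)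
  qed
  thus ?thesis by (simp add: bessel_J_def bessel_clifford_def)
qed

section \<open>Integrating series and Laplace-type integrals\<close>

lemma sum_exp_series_le:
  fixes t :: real
  assumes "t \<ge> 0"
  shows "(\<Sum>n<N. t ^ n / fact n) \<le> exp t"
proof -
  have "(\<Sum>n<N. t ^ n / fact n) \<le> (\<Sum>n. t ^ n / fact n)"
    using summable_exp[of t] assms by (intro sum_le_suminf) (auto simp: field_simps)
  thus ?thesis by (simp add: exp_def field_simps)
qed

lemma integral_sums_dominated:
  fixes f :: "nat \<Rightarrow> 'a \<Rightarrow> 'b :: {banach, second_countable_topology}"
  assumes meas: "\<And>n. f n \<in> borel_measurable M"
    and sums: "\<And>x. x \<in> space M \<Longrightarrow> (\<lambda>n. f n x) sums F x"
    and bound: "\<And>x N. x \<in> space M \<Longrightarrow> (\<Sum>n<N. norm (f n x)) \<le> G x"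
    and G: "integrable M G"
  shows "(\<lambda>n. integral\<^sup>L M (f n)) sums integral\<^sup>L M F"
proof -
  have int: "integrable M (f n)" for n
  proof (rule Bochner_Integration.integrable_bound[OF G meas])
    have "norm (f n x) \<le> norm (G x)" if "x \<in> space M" for x
    proof -
      have "norm (f n x) \<le> (\<Sum>k<Suc n. norm (f k x))" by (intro member_le_sum) auto
      also have "\<dots> \<le> G x" by (rule bound[OF that])
      finally show ?thesis by simp
    qed
    thus "AE x in M. norm (f n x) \<le> norm (G x)" by auto
  qed
  have lim: "AE x in M. (\<lambda>N. \<Sum>n<N. f n x) \<longlonglongrightarrow> F x"
    using sums by (auto simp: sums_def)
  have F: "F \<in> borel_measurable M"
    by (rule borel_measurable_LIMSEQ_metric[where f = "\<lambda>N x. \<Sum>n<N. f n x"])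
       (use meas sums in \<open>auto simp: sums_def\<close>)
  have le: "AE x in M. norm (\<Sum>n<N. f n x) \<le> G x" for N
    by (intro AE_I2 order_trans[OF norm_sum bound])
  have "(\<lambda>N. integral\<^sup>L M (\<lambda>x. \<Sum>n<N. f n x)) \<longlonglongrightarrow> integral\<^sup>L M F"
    by (rule integral_dominated_convergence[OF F _ G lim le]) (use meas in auto)
  thus ?thesis by (simp add: sums_def int)
qed

text \<open>
  Expanding \<open>exp (- (w - a) u)\<close> in powers of \<open>w - a\<close> turns the integral into a power series around any
  \<open>a\<close> of the half-plane. On the disc \<open>\<bar>w - a\<bar> < Re a\<close> the partial sums stay below
  \<open>\<bar>g\<bar> exp (- (Re a - \<bar>w - a\<bar>) u)\<close>, which is integrable.
\<close>

lemma holomorphic_on_Laplace_integral: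
  fixes g :: "'a \<Rightarrow> complex" and u :: "'a \<Rightarrow> real"
  assumes meas [measurable]: "g \<in> borel_measurable M" "u \<in> borel_measurable M"
    and u: "\<And>x. u x \<ge> 0"
    and int: "\<And>e. e > 0 \<Longrightarrow> integrable M (\<lambda>x. norm (g x) * exp (- (e * u x)))"
  shows "(\<lambda>a. LINT x|M. g x * exp (- a * of_real (u x))) holomorphic_on {a. Re a > 0}"
proof -
  define H where "H = (\<lambda>a. LINT x|M. g x * exp (- a * of_real (u x)))"
  have "H field_differentiable (at a)" if a: "Re a > 0" for a
  proof -
    define h where "h = (\<lambda>n. LINT x|M. g x * exp (- a * of_real (u x)) * (- of_real (u x)) ^ n / fact n)"
    have "(\<lambda>n. h n * (w - a) ^ n) sums H w" if w: "w \<in> ball a (Re a)" for w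
    proof -
      define f where "f = (\<lambda>n x. g x * exp (- a * of_real (u x)) * (- of_real (u x)) ^ n / fact n * (w - a) ^ n)"
      define e where "e = Re a - norm (w - a)"
      have e: "e > 0" using w by (simp add: e_def dist_norm norm_minus_commute)
      have "(\<lambda>n. integral\<^sup>L M (f n)) sums H w"
        unfolding H_def
      proof (rule integral_sums_dominated)
        show "f n \<in> borel_measurable M" for n unfolding f_def by measurable
        show "integrable M (\<lambda>x. norm (g x) * exp (- (e * u x)))" by (rule int[OF e])
        fix x
        have "(\<lambda>n. g x * exp (- a * of_real (u x)) * ((- of_real (u x) * (w - a)) ^ n /\<^sub>R fact n))
            sums (g x * exp (- a * of_real (u x)) * exp (- of_real (u x) * (w - a)))"
          by (intro sums_mult exp_converges)
        moreover have "exp (- a * of_real (u x)) * exp (- of_real (u x) * (w - a)) = exp (- w * of_real (u x))"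
          by (simp add: exp_add[symmetric] algebra_simps)
        moreover have "f n x = g x * exp (- a * of_real (u x)) * ((- of_real (u x) * (w - a)) ^ n /\<^sub>R fact n)" for n
          unfolding f_def power_mult_distrib by (simp add: scaleR_conv_of_real divide_inverse)
        ultimately show "(\<lambda>n. f n x) sums (g x * exp (- w * of_real (u x)))"
          by (simp add: mult.assoc)
        fix N
        have "(\<Sum>n<N. norm (f n x)) = norm (g x) * exp (- (Re a * u x)) *
            (\<Sum>n<N. (u x * norm (w - a)) ^ n / fact n)"
          by (simp add: f_def norm_mult norm_divide norm_power sum_distrib_left u power_mult_distrib mult_ac)
        also have "\<dots> \<le> norm (g x) * exp (- (Re a * u x)) * exp (u x * norm (w - a))"
          by (intro mult_left_mono sum_exp_series_le) (auto simp: u)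
        also have "\<dots> = norm (g x) * exp (- (e * u x))"
          by (simp add: e_def mult.assoc exp_add[symmetric] algebra_simps)
        finally show "(\<Sum>n<N. norm (f n x)) \<le> norm (g x) * exp (- (e * u x))" .
      qed
      moreover have "integral\<^sup>L M (f n) = h n * (w - a) ^ n" for n
        by (simp add: f_def h_def)
      ultimately show ?thesis by simp
    qed
    hence "H holomorphic_on ball a (Re a)" by (rule power_series_holomorphic)
    thus ?thesis
      by (rule holomorphic_on_imp_differentiable_at) (use a in auto)
  qed
  thus ?thesis
    unfolding H_def[symmetric] by (auto simp: holomorphic_on_def intro: field_differentiable_at_within)
qed

section \<open>The Gamma integral with a power in the exponent\<close>

lemma powr_of_real_pos:
  assumes "t > 0"
  shows "complex_of_real t powr z = exp (z * of_real (ln t))"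
  using assms by (simp add: powr_def Ln_of_real)

text \<open>
  The substitution \<open>t = a x powr \<xi>\<close> reduces both claims to Euler's integral for \<open>Gamma (s / \<xi>)\<close>. Real \<open>a\<close>
  suffices, because complex \<open>a\<close> is reached later by analytic continuation.
\<close>

lemma
  fixes s :: complex and a \<xi> :: real
  assumes s: "Re s > 0" and a: "a > 0" and \<xi>: "\<xi> > 0"
  shows set_integrable_powr_exp_powr:
      "set_integrable lborel {0<..} (\<lambda>x. of_real x powr (s - 1) * of_real (exp (- (a * x powr \<xi>))))"
    and set_integral_powr_exp_powr:
      "(LINT x:{0<..}|lborel. of_real x powr (s - 1) * of_real (exp (- (a * x powr \<xi>))))
         = Gamma (s / of_real \<xi>) * of_real a powr (- (s / of_real \<xi>)) / of_real \<xi>"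
proof -
  let ?S = "{0::real<..}"
  define F where "F = (\<lambda>x. complex_of_real x powr (s - 1) * of_real (exp (- (a * x powr \<xi>))))"
  define r where "r = s / of_real \<xi>"
  (* The Jacobian and the powers of a combine to this constant: |g' x| f(g x) = K F x. *)
  define K where "K = of_real \<xi> * of_real a powr r"
  have K: "K \<noteq> 0" using \<xi> a by (simp add: K_def)
  define f where "f = (\<lambda>t. complex_of_real t powr (r - 1) / of_real (exp t))"
  define g where "g = (\<lambda>x. a * x powr \<xi>)"
  define g' where "g' = (\<lambda>x. a * (\<xi> * x powr (\<xi> - 1)))"
  have r: "Re r > 0" using s \<xi> by (simp add: r_def)
  have img: "g ` ?S = ?S"
  proof safe
    fix t :: real assume t: "t > 0"
    show "t \<in> g ` {0<..}"
      by (rule image_eqI[of _ _ "(t / a) powr (1 / \<xi>)"]) (use t a \<xi> in \<open>auto simp: g_def powr_powr\<close>)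
  qed (use a in \<open>auto simp: g_def\<close>)
  have inj: "inj_on g ?S"
  proof (rule inj_onI)
    fix x y assume "x \<in> ?S" "y \<in> ?S" "g x = g y"
    hence "(x powr \<xi>) powr (1 / \<xi>) = (y powr \<xi>) powr (1 / \<xi>)" "x > 0" "y > 0"
      using a by (auto simp: g_def)
    thus "x = y" using \<xi> by (simp add: powr_powr)
  qed
  have "(\<lambda>x. \<bar>g' x\<bar> *\<^sub>R f (g x)) absolutely_integrable_on ?S \<and>
      integral ?S (\<lambda>x. \<bar>g' x\<bar> *\<^sub>R f (g x)) = Gamma r \<longleftrightarrow>
      f absolutely_integrable_on g ` ?S \<and> integral (g ` ?S) f = Gamma r"
    by (rule has_absolute_integral_change_of_variables_real[OF _ _ inj])
       (use a in \<open>auto simp: g_def g'_def intro!: derivative_eq_intros\<close>)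
  moreover have "f absolutely_integrable_on ?S"
    unfolding f_def by (rule absolutely_integrable_Gamma_integral'[OF r])
  moreover have "integral ?S f = Gamma r"
    unfolding f_def by (rule integral_unique[OF Gamma_integral_complex'[OF r]])
  ultimately have *: "(\<lambda>x. \<bar>g' x\<bar> *\<^sub>R f (g x)) absolutely_integrable_on ?S"
      "integral ?S (\<lambda>x. \<bar>g' x\<bar> *\<^sub>R f (g x)) = Gamma r" unfolding img by auto
  have eq: "\<bar>g' x\<bar> *\<^sub>R f (g x) = K * F x" if "x \<in> ?S" for x
  proof -
    have x: "x > 0" using that by simp
    have "complex_of_real (g x) powr (r - 1) = of_real a powr (r - 1) * of_real (x powr \<xi>) powr (r - 1)"
      using a x by (simp add: g_def powr_times_real)
    also have "complex_of_real (x powr \<xi>) powr (r - 1) = of_real x powr (of_real \<xi> * (r - 1))"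
      using x by (simp add: powr_of_real_pos mult_ac)
    also have "of_real a powr (r - 1) = of_real a powr r / of_real a"
      using a by (simp add: powr_diff)
    finally have 1: "complex_of_real (g x) powr (r - 1) =
        of_real a powr r / of_real a * of_real x powr (of_real \<xi> * (r - 1))" .
    have "complex_of_real (x powr (\<xi> - 1)) * of_real x powr (of_real \<xi> * (r - 1)) =
        of_real x powr (of_real (\<xi> - 1) + of_real \<xi> * (r - 1))"
      using x by (simp add: powr_add flip: powr_of_real)
    also have "of_real (\<xi> - 1) + of_real \<xi> * (r - 1) = s - 1"
      using \<xi> by (simp add: r_def algebra_simps)
    finally have 2: "complex_of_real (x powr (\<xi> - 1)) * of_real x powr (of_real \<xi> * (r - 1)) = of_real x powr (s - 1)" .
    have "\<bar>g' x\<bar> *\<^sub>R f (g x) = of_real a * of_real \<xi> * complex_of_real (x powr (\<xi> - 1)) *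
        (of_real a powr r / of_real a * of_real x powr (of_real \<xi> * (r - 1)) / of_real (exp (a * x powr \<xi>)))"
      using a \<xi> x unfolding f_def 1
      by (simp add: g'_def g_def abs_mult scaleR_conv_of_real mult_ac)
    also have "\<dots> = of_real \<xi> * of_real a powr r * (complex_of_real (x powr (\<xi> - 1)) * of_real x powr (of_real \<xi> * (r - 1)))
        / of_real (exp (a * x powr \<xi>))"
      using a by simp
    also have "\<dots> = K * F x"
      unfolding 2 by (simp add: F_def K_def exp_minus divide_inverse)
    finally show ?thesis .
  qed
  have "(\<lambda>x. K * F x) absolutely_integrable_on ?S"
    using set_integrable_cong[of lebesgue lebesgue ?S ?S "\<lambda>x. \<bar>g' x\<bar> *\<^sub>R f (g x)" "\<lambda>x. K * F x"] *(1) eq by auto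
  hence int: "F absolutely_integrable_on ?S" using K by (simp add: set_integrable_mult_right_iff)
  have "integral ?S (\<lambda>x. K * F x) = Gamma r"
    using *(2) eq integral_cong[of ?S "\<lambda>x. \<bar>g' x\<bar> *\<^sub>R f (g x)" "\<lambda>x. K * F x"] by simp
  hence val: "integral ?S F = Gamma r / K"
    using K by (simp add: field_simps)
  have "(\<lambda>x. indicator ?S x *\<^sub>R F x) \<in> borel_measurable borel"
    unfolding F_def by measurable
  thus int': "set_integrable lborel {0<..} F"
    using int unfolding set_integrable_def by (simp add: integrable_completion)
  have "(LINT x:?S|lborel. F x) = integral ?S F"
    by (rule set_borel_integral_eq_integral(2)[OF int'])
  also have "\<dots> = Gamma r * of_real a powr (-r) / of_real \<xi>"
    unfolding val K_def by (simp add: powr_minus divide_inverse mult_ac)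
  finally show "(LINT x:?S|lborel. F x) = Gamma (s / of_real \<xi>) * of_real a powr (- (s / of_real \<xi>)) / of_real \<xi>"
    by (simp add: r_def)
qed

section \<open>Abel's limit theorem\<close>

text \<open>
  Summation by parts writes the error as \<open>(1 - q) \<Sum> t\<^sub>n q\<^sup>n\<close>, where \<open>t\<^sub>n\<close> is the error of the \<open>n\<close>-th partial
  sum. The weights \<open>(1 - q) q\<^sup>n\<close> have total mass 1, and as \<open>q\<close> tends to 1 they leave every finite set of
  indices, so only the small tail of \<open>t\<close> contributes.
\<close>

lemma Abel_limit:
  fixes c :: "nat \<Rightarrow> complex"
  assumes "summable c"
  shows "((\<lambda>q. \<Sum>n. c n * of_real q ^ n) \<longlongrightarrow> suminf c) (at_left (1 :: real))"
proof -
  define s where "s = suminf c"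
  define t where "t = (\<lambda>n. (\<Sum>k\<le>n. c k) - s)"
  have t0: "t \<longlonglongrightarrow> 0"
    unfolding t_def s_def by (rule LIM_zero[OF summable_LIMSEQ'[OF assms]])
  then obtain B where B: "\<And>n. norm (t n) \<le> B"
    using convergent_imp_Bseq[of t] by (auto simp: convergent_def Bseq_def)
  have sm: "summable (\<lambda>n. norm (t n) * q ^ n)" if "0 < q" "q < 1" for q :: real
    by (rule summable_comparison_test'[where g = "\<lambda>n. B * q ^ n" and N = 0])
       (use that B in \<open>auto intro!: summable_mult summable_geometric mult_right_mono\<close>)
  have sm': "summable (\<lambda>n. t n * of_real q ^ n)" if "0 < q" "q < 1" for q :: real
    using sm[OF that] that by (intro summable_norm_cancel[of "\<lambda>n. t n * of_real q ^ n"]) (simp add: norm_mult norm_power)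
  have eq: "(\<Sum>n. c n * of_real q ^ n) - s = (1 - of_real q) * (\<Sum>n. t n * of_real q ^ n)"
    if q: "0 < q" "q < 1" for q :: real
  proof -
    let ?T = "\<Sum>n. t n * of_real q ^ n"
    have T: "(\<lambda>n. t n * of_real q ^ n) sums ?T" using sm'[OF q] by (rule summable_sums)
    define d where "d = (\<lambda>n. if n = 0 then - s else of_real q * (t (n - 1) * of_real q ^ (n - 1)))"
    have "(\<lambda>n. d (Suc n)) sums (of_real q * ?T)"
      unfolding d_def using sums_mult[OF T] by simp
    hence "d sums (of_real q * ?T - s)"
      by (subst (asm) sums_Suc_iff) (simp add: d_def)
    from sums_diff[OF T this] have "(\<lambda>n. t n * of_real q ^ n - d n) sums (?T - (of_real q * ?T - s))" .
    moreover have "t n * of_real q ^ n - d n = c n * of_real q ^ n" for n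
      by (cases n) (simp_all add: t_def d_def algebra_simps)
    ultimately have "(\<lambda>n. c n * of_real q ^ n) sums (?T - (of_real q * ?T - s))" by simp
    thus ?thesis by (simp add: sums_iff algebra_simps)
  qed
  have "((\<lambda>q. (\<Sum>n. c n * of_real q ^ n) - s) \<longlongrightarrow> 0) (at_left (1 :: real))"
  proof (rule tendstoI)
    fix e :: real assume e: "e > 0"
    obtain N where N: "\<And>n. n \<ge> N \<Longrightarrow> norm (t n) < e / 2"
      using LIMSEQ_D[OF t0, of "e / 2"] e by auto
    have "((\<lambda>q. (1 - q) * (\<Sum>n<N. norm (t n))) \<longlongrightarrow> (1 - 1) * (\<Sum>n<N. norm (t n))) (at_left (1::real))"
      by (intro tendsto_intros)
    hence "eventually (\<lambda>q. (1 - q) * (\<Sum>n<N. norm (t n)) < e / 2) (at_left (1 :: real))"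
      using e by (intro order_tendstoD) auto
    moreover have "eventually (\<lambda>q. q \<in> {0<..<1}) (at_left (1 :: real))"
      by (rule eventually_at_left_real) auto
    ultimately show "eventually (\<lambda>q. dist ((\<Sum>n. c n * of_real q ^ n) - s) 0 < e) (at_left (1 :: real))"
    proof eventually_elim
      case (elim q)
      hence q: "0 < q" "q < 1" by auto
      have head: "norm (t n) * q ^ n \<le> (if n < N then norm (t n) else 0) + e / 2 * q ^ n" for n
      proof (cases "n < N")
        case True
        have "norm (t n) * q ^ n \<le> norm (t n) * 1"
          using q by (intro mult_left_mono power_le_one) auto
        moreover have "e / 2 * q ^ n \<ge> 0" using e q by auto
        ultimately show ?thesis using True by simp
      next
        case False
        thus ?thesis using N[of n] q by (auto intro!: mult_right_mono)
      qed
      have fin: "(\<lambda>n. if n < N then norm (t n) else 0) sums (\<Sum>n<N. norm (t n))"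
        using sums_If_finite_set[of "{..<N}" "\<lambda>n. norm (t n)"] by simp
      have geo: "(\<lambda>n. e / 2 * q ^ n) sums (e / 2 * (1 / (1 - q)))"
        by (intro sums_mult geometric_sums) (use q in auto)
      have "norm (\<Sum>n. t n * of_real q ^ n) \<le> (\<Sum>n. norm (t n) * q ^ n)"
        using summable_norm[of "\<lambda>n. t n * of_real q ^ n"] sm[OF q] q by (simp add: norm_mult norm_power)
      also have "\<dots> \<le> (\<Sum>n<N. norm (t n)) + e / 2 * (1 / (1 - q))"
        using head by (intro sums_le[OF _ summable_sums[OF sm[OF q]] sums_add[OF fin geo]])
      finally have "(1 - q) * norm (\<Sum>n. t n * of_real q ^ n) \<le>
          (1 - q) * ((\<Sum>n<N. norm (t n)) + e / 2 * (1 / (1 - q)))"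
        using q by (intro mult_left_mono) auto
      also have "\<dots> = (1 - q) * (\<Sum>n<N. norm (t n)) + e / 2"
        using q by (simp add: field_simps)
      also have "\<dots> < e" using elim by simp
      finally have "(1 - q) * norm (\<Sum>n. t n * of_real q ^ n) < e" .
      moreover have "norm (1 - complex_of_real q) = 1 - q"
        using q norm_of_real[of "1 - q", where ?'a = complex] by simp
      ultimately show ?case
        by (simp add: eq[OF q] norm_mult)
    qed
  qed
  from tendsto_add[OF this tendsto_const[of s]] show ?thesis by (simp add: s_def)
qed

section \<open>Divergence of the Fox--Wright series\<close>

text \<open>
  A crude substitute for Stirling's formula. Write \<open>t = n + f\<close> with \<open>n\<close> the integer part: \<open>Gamma\<close> has a
  positive minimum modulus on the segment \<open>s + [0, 1]\<close>, and the recurrence supplies \<open>n\<close> factors of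
  modulus at least \<open>Re s + j\<close>.
\<close>

lemma norm_Gamma_add_real_ge:
  assumes s: "Re s > 0"
  obtains d where "d > 0" "\<And>t::real. t \<ge> 1 \<Longrightarrow> norm (Gamma (s + of_real t)) \<ge> d * fact (nat \<lfloor>t\<rfloor> - 1)"
proof -
  have pole_free: "s + of_real t \<notin> \<int>\<^sub>\<le>\<^sub>0" if "t \<ge> 0" for t
    using that s by (auto elim!: nonpos_Ints_cases simp: complex_eq_iff)
  have "continuous_on {0..1} (\<lambda>t. norm (Gamma (s + of_real t)))"
    using pole_free
    by (intro continuous_on_norm continuous_on_compose2[OF continuous_on_Gamma[of "- \<int>\<^sub>\<le>\<^sub>0"]])
       (auto intro!: continuous_intros)
  then obtain f0 :: real where f0: "f0 \<in> {0..1}"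
      "\<And>f. f \<in> {0..1} \<Longrightarrow> norm (Gamma (s + of_real f0)) \<le> norm (Gamma (s + of_real f))"
    using continuous_attains_inf[of "{0..1::real}"] by (metis atLeastatMost_empty_iff compact_Icc not_one_le_zero linorder_linear)
  define d where "d = norm (Gamma (s + of_real f0)) * Re s"
  show ?thesis
  proof (rule that[of d])
    show "d > 0" using f0 pole_free s by (auto simp: d_def Gamma_eq_zero_iff)
    fix t :: real assume t: "t \<ge> 1"
    define n where "n = nat \<lfloor>t\<rfloor>"
    define f where "f = t - real n"
    have f: "f \<in> {0..1}" and n: "n \<ge> 1" using t unfolding f_def n_def by (simp_all, linarith+)
    then obtain m where m: "n = Suc m" by (cases n) auto
    have ge: "norm (s + of_real f + of_nat j) \<ge> Re s + real j" for j
      using complex_Re_le_cmod[of "s + of_real f + of_nat j"] f by simp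
    have "Re s * fact m \<le> (\<Prod>j<Suc m. norm (s + of_real f + of_nat j))"
    proof -
      have "(\<Prod>j<m. real (Suc j)) \<le> (\<Prod>j<m. norm (s + of_real f + of_nat (Suc j)))"
        by (intro prod_mono conjI order_trans[OF _ ge]) (use s in auto)
      moreover have "(\<Prod>j<m. real (Suc j)) = fact m"
        by (simp add: fact_prod_Suc lessThan_atLeast0)
      moreover have "Re s \<le> norm (s + of_real f + of_nat 0)" using ge[of 0] by simp
      ultimately show ?thesis
        unfolding prod.lessThan_Suc_shift using s by (intro mult_mono) auto
    qed
    also have "\<dots> = norm (pochhammer (s + of_real f) n)"
      by (simp add: m pochhammer_prod prod_norm lessThan_atLeast0)
    finally have "norm (Gamma (s + of_real f0)) * (Re s * fact m) \<le>
        norm (Gamma (s + of_real f)) * norm (pochhammer (s + of_real f) n)"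
      using f0 f s by (intro mult_mono) auto
    also have "\<dots> = norm (Gamma (s + of_real f + of_nat n))"
      using pole_free[of f] f by (simp add: pochhammer_Gamma norm_divide Gamma_eq_zero_iff)
    also have "s + of_real f + of_nat n = s + of_real t" by (simp add: f_def)
    finally show "norm (Gamma (s + of_real t)) \<ge> d * fact (nat \<lfloor>t\<rfloor> - 1)"
      by (simp add: d_def m flip: n_def)
  qed
qed

lemma norm_Gamma_add_nat_le:
  assumes "s \<notin> \<int>\<^sub>\<le>\<^sub>0"
  shows "norm (Gamma (s + of_nat k :: complex)) \<le> norm (Gamma s) * (norm s + 1) ^ k * fact k"
proof -
  have "norm (pochhammer s k) = (\<Prod>j<k. norm (s + of_nat j))"
    by (simp add: pochhammer_prod prod_norm lessThan_atLeast0)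
  also have "\<dots> \<le> (\<Prod>j<k. (norm s + 1) * real (Suc j))"
  proof (intro prod_mono conjI norm_ge_zero)
    fix j
    have "norm (s + of_nat j) \<le> norm s + real j"
      using norm_triangle_ineq[of s "of_nat j"] by simp
    also have "\<dots> \<le> (norm s + 1) * real (Suc j)" by (simp add: algebra_simps)
    finally show "norm (s + of_nat j) \<le> (norm s + 1) * real (Suc j)" .
  qed
  also have "\<dots> = (norm s + 1) ^ k * fact k"
    unfolding prod.distrib by (simp add: fact_prod_Suc lessThan_atLeast0)
  finally have "norm (Gamma s) * norm (pochhammer s k) \<le> norm (Gamma s) * ((norm s + 1) ^ k * fact k)"
    by (intro mult_left_mono) auto
  thus ?thesis using assms by (simp add: pochhammer_Gamma norm_divide Gamma_eq_zero_iff mult_ac)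
qed

lemma fact_square_times_power_le:
  "fact k ^ 2 * real k ^ p \<le> fact (2 * k + p)"
proof (induction p)
  case 0
  have "fact k * fact k dvd (fact (2 * k) :: nat)"
    by (metis mult_2 fact_fact_dvd_fact)
  hence "fact k * fact k \<le> (fact (2 * k) :: nat)" by (intro dvd_imp_le) auto
  hence "real (fact k * fact k) \<le> real (fact (2 * k))" by (intro of_nat_mono)
  thus ?case by (simp add: power2_eq_square)
next
  case (Suc p)
  have "fact k ^ 2 * real k ^ Suc p = real k * (fact k ^ 2 * real k ^ p)" by simp
  also have "\<dots> \<le> real (Suc (2 * k + p)) * fact (2 * k + p)"
    by (intro mult_mono Suc.IH) auto
  finally show ?case by simp
qed

text \<open>
  The terms do not tend to 0. With \<open>h = \<tau> - 2 > 0\<close>, the numerator grows at least like \<open>(2 k + p)!\<close> for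
  some \<open>p \<ge> h k - 2\<close>, hence at least like \<open>(k!)\<^sup>2 k\<^sup>p\<close>. The denominator is at most of order \<open>m\<^sup>k (k!)\<^sup>2\<close>, so the
  terms are bounded below by a constant times \<open>\<rho>\<^sup>k k\<^sup>p\<close>, which tends to infinity however small \<open>\<rho>\<close> is.
\<close>

lemma not_summable_fox_wright_term:
  fixes \<sigma> \<nu> z :: complex and \<tau> :: real
  assumes \<sigma>: "Re \<sigma> > 0" and \<tau>: "\<tau> > 2" and \<nu>: "\<nu> + 1 \<notin> \<int>\<^sub>\<le>\<^sub>0" and z: "z \<noteq> 0"
  shows "\<not> summable (fox_wright_term [(\<sigma>, \<tau>)] [(\<nu> + 1, 1)] z)"
proof
  assume "summable (fox_wright_term [(\<sigma>, \<tau>)] [(\<nu> + 1, 1)] z)"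
  hence lim: "fox_wright_term [(\<sigma>, \<tau>)] [(\<nu> + 1, 1)] z \<longlonglongrightarrow> 0"
    by (rule summable_LIMSEQ_zero)
  obtain d where d: "d > 0" "\<And>t::real. t \<ge> 1 \<Longrightarrow> norm (Gamma (\<sigma> + of_real t)) \<ge> d * fact (nat \<lfloor>t\<rfloor> - 1)"
    using norm_Gamma_add_real_ge[OF \<sigma>] by blast
  define G where "G = norm (Gamma (\<nu> + 1))"
  have G: "G > 0" using \<nu> by (simp add: G_def Gamma_eq_zero_iff)
  define m where "m = norm (\<nu> + 1) + 1"
  have m: "m > 0" unfolding m_def by (simp add: add_nonneg_pos)
  define \<rho> where "\<rho> = norm z / m"
  have \<rho>: "\<rho> > 0" using z m by (simp add: \<rho>_def)
  define h where "h = \<tau> - 2"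
  have h: "h > 0" using \<tau> by (simp add: h_def)
  have "d / G \<le> norm (fox_wright_term [(\<sigma>, \<tau>)] [(\<nu> + 1, 1)] z k)"
    if k: "real k \<ge> 1" "real k \<ge> 6 / h" "real k \<ge> (1 / \<rho>) powr (2 / h)" for k
  proof -
    define t where "t = real k * \<tau>"
    have hk: "real k * h \<ge> 6" using k(2) h by (simp add: field_simps)
    have t_eq: "t = 2 * real k + real k * h" by (simp add: t_def h_def algebra_simps)
    have t: "t \<ge> 1" using hk k(1) by (simp add: t_eq)
    define p where "p = nat \<lfloor>t\<rfloor> - 1 - 2 * k"
    have p: "nat \<lfloor>t\<rfloor> - 1 = 2 * k + p" "real p \<ge> real k * h - 2"
      unfolding p_def using hk t_eq by linarith+
    (* Since k h >= 6 gives p >= k h / 2, half of the exponent suffices to absorb rho^k. *)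
    have "1 \<le> (\<rho> * real k powr (h / 2)) ^ k"
    proof (rule one_le_power)
      have "1 / \<rho> = ((1 / \<rho>) powr (2 / h)) powr (h / 2)"
        using \<rho> h by (simp add: powr_powr)
      also have "\<dots> \<le> real k powr (h / 2)" using k h \<rho> by (intro powr_mono2) auto
      finally show "1 \<le> \<rho> * real k powr (h / 2)" using \<rho> by (simp add: field_simps)
    qed
    also have "\<dots> = \<rho> ^ k * real k powr (real k * h / 2)"
      using k(1) by (simp add: power_mult_distrib powr_power mult_ac)
    also have "\<dots> \<le> \<rho> ^ k * real k powr (real p)"
      using k(1) p(2) hk \<rho> by (intro mult_left_mono powr_mono) auto
    also have "real k powr (real p) = real k ^ p" using k(1) by (simp add: powr_realpow)
    finally have 1: "1 \<le> \<rho> ^ k * real k ^ p" .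
    have num: "d * (fact k ^ 2 * real k ^ p) \<le> norm (Gamma (\<sigma> + of_real t))"
      using d(1) d(2)[OF t] fact_square_times_power_le[of k p] unfolding p
      by (meson mult_left_mono less_imp_le order_trans)
    have den: "norm (Gamma (\<nu> + 1 + of_nat k)) \<le> G * m ^ k * fact k"
      unfolding G_def m_def by (rule norm_Gamma_add_nat_le[OF \<nu>])
    have "\<nu> + 1 + of_nat k \<notin> \<int>\<^sub>\<le>\<^sub>0"
    proof
      assume "\<nu> + 1 + of_nat k \<in> \<int>\<^sub>\<le>\<^sub>0"
      then obtain n where "\<nu> + 1 + of_nat k = - of_nat n" by (elim nonpos_Ints_cases')
      hence "\<nu> + 1 = - of_nat n - of_nat k" by (simp only: eq_diff_eq)
      hence "\<nu> + 1 = - of_nat (n + k)" by simp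
      with \<nu> show False by (metis minus_of_nat_in_nonpos_Ints)
    qed
    hence pos: "norm (Gamma (\<nu> + 1 + of_nat k)) > 0" by (simp add: Gamma_eq_zero_iff)
    have "d / G * 1 \<le> d / G * (\<rho> ^ k * real k ^ p)"
      using d(1) G 1 by (intro mult_left_mono) auto
    also have "\<dots> = d * (fact k ^ 2 * real k ^ p) / (G * m ^ k * fact k) * (norm z ^ k / fact k)"
      using m G by (simp add: \<rho>_def power_divide power2_eq_square)
    also have "\<dots> \<le> norm (Gamma (\<sigma> + of_real t)) / norm (Gamma (\<nu> + 1 + of_nat k)) * (norm z ^ k / fact k)"
      using pos d(1) by (intro mult_right_mono frac_le num den) auto
    also have "\<dots> = norm (fox_wright_term [(\<sigma>, \<tau>)] [(\<nu> + 1, 1)] z k)"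
      by (simp add: fox_wright_term_def t_def norm_mult norm_divide norm_power)
    finally show ?thesis by simp
  qed
  hence "eventually (\<lambda>k. d / G \<le> norm (fox_wright_term [(\<sigma>, \<tau>)] [(\<nu> + 1, 1)] z k)) sequentially"
    using eventually_ge_at_top[of "nat \<lceil>max 1 (max (6 / h) ((1 / \<rho>) powr (2 / h)))\<rceil>"]
    by (elim eventually_mono) (auto simp: nat_le_iff ceiling_le_iff)
  moreover have "eventually (\<lambda>k. norm (fox_wright_term [(\<sigma>, \<tau>)] [(\<nu> + 1, 1)] z k) < d / G) sequentially"
    using order_tendstoD(2)[OF tendsto_norm[OF lim], of "d / G"] d(1) G by simp
  ultimately have "eventually (\<lambda>k::nat. False) sequentially"
    by eventually_elim simp
  thus False by simp
qed

section \<open>The integral as a function on the right half-plane\<close>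

text \<open>
  Extending the integrand by 0 to the whole line allows integrals over the plain Lebesgue measure.
\<close>

definition hankel_kernel :: "complex \<Rightarrow> complex \<Rightarrow> real \<Rightarrow> real \<Rightarrow> complex" where
  "hankel_kernel s \<nu> y x =
     indicator {0<..} x *\<^sub>R (of_real x powr (s - 1) * bessel_clifford \<nu> (- (of_real (x * y) ^ 2 / 4)))"

lemma measurable_hankel_kernel [measurable]: "hankel_kernel s \<nu> y \<in> borel_measurable borel"
proof -
  have "continuous_on UNIV (bessel_clifford \<nu>)"
    using has_field_derivative_bessel_clifford by (intro DERIV_continuous_on) (auto intro: has_field_derivative_at_within)
  hence [measurable]: "bessel_clifford \<nu> \<in> borel_measurable borel"
    by (rule borel_measurable_continuous_onI)
  show ?thesis unfolding hankel_kernel_def by measurable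
qed

text \<open>
  By the polynomial growth of \<open>C\<^sub>\<nu>\<close>, the kernel is dominated by two Gamma integrands, with parameters \<open>s\<close>
  and \<open>s + M\<close>.
\<close>

lemma integrable_hankel_kernel:
  assumes s: "Re s > 0" and \<xi>: "\<xi> > 0" and y: "y > 0" and e: "e > 0"
  shows "integrable lborel (\<lambda>x. norm (hankel_kernel s \<nu> y x) * exp (- (e * x powr \<xi>)))"
proof -
  obtain C M where CM: "C \<ge> 0" "M \<ge> 0"
    "\<And>x::real. x \<ge> 0 \<Longrightarrow> norm (bessel_clifford \<nu> (- (of_real x ^ 2 / 4))) \<le> C * (1 + x powr M)"
    using bessel_clifford_polynomial_bound by blast
  define F where "F = (\<lambda>s x. indicator {0<..} x *\<^sub>R (complex_of_real x powr (s - 1) * of_real (exp (- (e * x powr \<xi>)))))"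
  have F: "integrable lborel (\<lambda>x. norm (F s x))" if "Re s > 0" for s
    using set_integrable_powr_exp_powr[OF that e \<xi>] unfolding F_def set_integrable_def
    by (rule integrable_norm)
  have "integrable lborel (\<lambda>x. C * (norm (F s x) + y powr M * norm (F (s + of_real M) x)))"
    by (intro integrable_mult_right Bochner_Integration.integrable_add F)
       (use s CM in auto)
  thus ?thesis
  proof (rule Bochner_Integration.integrable_bound)
    show "(\<lambda>x. norm (hankel_kernel s \<nu> y x) * exp (- (e * x powr \<xi>))) \<in> borel_measurable lborel"
      by measurable
    show "AE x in lborel. norm (norm (hankel_kernel s \<nu> y x) * exp (- (e * x powr \<xi>)))
        \<le> norm (C * (norm (F s x) + y powr M * norm (F (s + of_real M) x)))"
    proof (intro AE_I2)
      fix x :: real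
      show "norm (norm (hankel_kernel s \<nu> y x) * exp (- (e * x powr \<xi>)))
        \<le> norm (C * (norm (F s x) + y powr M * norm (F (s + of_real M) x)))"
      proof (cases "x > 0")
        case x: True
        have n: "norm (complex_of_real x powr z) = x powr Re z" for z
          using x by (simp add: norm_powr_real_powr)
        have "norm (hankel_kernel s \<nu> y x) * exp (- (e * x powr \<xi>)) \<le>
            x powr (Re s - 1) * (C * (1 + (x * y) powr M)) * exp (- (e * x powr \<xi>))"
          using x y CM(3)[of "x * y"]
          by (auto simp: hankel_kernel_def norm_mult n intro!: mult_left_mono mult_right_mono)
        also have "\<dots> = C * (norm (F s x) + y powr M * norm (F (s + of_real M) x))"
        proof -
          have "x powr (Re s + M - 1) = x powr (Re s - 1) * x powr M"
            using x by (simp flip: powr_add add: algebra_simps)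
          thus ?thesis using x y by (simp add: F_def norm_mult n powr_mult algebra_simps)
        qed
        finally show ?thesis using CM(1) by simp
      qed (simp add: hankel_kernel_def CM)
    qed
  qed
qed

definition hankel_Laplace :: "complex \<Rightarrow> complex \<Rightarrow> real \<Rightarrow> real \<Rightarrow> complex \<Rightarrow> complex" where
  "hankel_Laplace s \<nu> y \<xi> a = (LINT x|lborel. hankel_kernel s \<nu> y x * exp (- a * of_real (x powr \<xi>)))"

lemma holomorphic_hankel_Laplace:
  assumes "Re s > 0" "\<xi> > 0" "y > 0"
  shows "hankel_Laplace s \<nu> y \<xi> holomorphic_on {a. Re a > 0}"
  unfolding hankel_Laplace_def [abs_def]
  by (rule holomorphic_on_Laplace_integral) (use integrable_hankel_kernel[OF assms] in auto)

lemma integrable_hankel_Laplace: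
  assumes "Re s > 0" "\<xi> > 0" "y > 0" "Re a > 0"
  shows "integrable lborel (\<lambda>x. hankel_kernel s \<nu> y x * exp (- a * of_real (x powr \<xi>)))"
proof (rule integrable_norm_cancel)
  show "integrable lborel (\<lambda>x. norm (hankel_kernel s \<nu> y x * exp (- a * of_real (x powr \<xi>))))"
    using integrable_hankel_kernel[OF assms, of \<nu>] by (simp add: norm_mult)
qed measurable

lemma norm_hankel_Laplace_le:
  assumes "Re s > 0" "\<xi> > 0" "y > 0" "e > 0" "Re a \<ge> e"
  shows "norm (hankel_Laplace s \<nu> y \<xi> a) \<le> (LINT x|lborel. norm (hankel_kernel s \<nu> y x) * exp (- (e * x powr \<xi>)))"
proof -
  have "norm (hankel_Laplace s \<nu> y \<xi> a) \<le> (LINT x|lborel. norm (hankel_kernel s \<nu> y x * exp (- a * of_real (x powr \<xi>))))"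
    unfolding hankel_Laplace_def by (rule integral_norm_bound)
  also have "\<dots> \<le> (LINT x|lborel. norm (hankel_kernel s \<nu> y x) * exp (- (e * x powr \<xi>)))"
    using assms
    by (intro integral_mono integrable_norm integrable_hankel_Laplace integrable_hankel_kernel)
       (auto simp: norm_mult intro!: mult_left_mono mult_right_mono)
  finally show ?thesis .
qed

section \<open>Term-by-term integration for large real parameters\<close>

lemma sum_squares_le_square_sum:
  fixes a :: "nat \<Rightarrow> real"
  assumes "\<And>k. a k \<ge> 0"
  shows "(\<Sum>k<N. a k ^ 2) \<le> (\<Sum>k<N. a k) ^ 2"
proof (induction N)
  case (Suc N)
  have "0 \<le> 2 * (\<Sum>k<N. a k) * a N" by (simp add: assms sum_nonneg)
  with Suc show ?case unfolding sum.lessThan_Suc power2_sum by linarith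
qed simp

lemma fox_wright_term_1_1:
  "fox_wright_term [(\<sigma>, \<tau>)] [(\<beta>, 1)] z k =
     Gamma (\<sigma> + of_nat k * of_real \<tau>) / Gamma (\<beta> + of_nat k) * (z ^ k / fact k)"
  by (simp add: fox_wright_term_def)

text \<open>
  The partial sums of the Bessel series are dominated by \<open>exp (2 x y)\<close>, and \<open>x \<le> 1 + x powr \<xi>\<close> for \<open>\<xi> \<ge> 1\<close>,
  so \<open>exp (- a x powr \<xi>)\<close> beats them once \<open>a > 2 y\<close>. The constant 2 is generous; the identity is only needed
  on some real half-line.
\<close>

lemma hankel_Laplace_real_sums:
  assumes s: "Re s > 0" and \<xi>: "\<xi> \<ge> 1" and y: "y > 0" and a: "a > 2 * y"
  shows "(\<lambda>k. of_real a powr (- (s / of_real \<xi>)) / of_real \<xi> *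
            fox_wright_term [(s / of_real \<xi>, 2 / \<xi>)] [(\<nu> + 1, 1)]
              (- (of_real y ^ 2 / (4 * of_real a powr of_real (2 / \<xi>)))) k)
         sums hankel_Laplace s \<nu> y \<xi> (of_real a)"
proof -
  let ?w = "\<lambda>x::real. - (complex_of_real (x * y) ^ 2 / 4)"
  define f where "f = (\<lambda>k x. indicator {0<..} x *\<^sub>R (of_real x powr (s - 1) *
      (rGamma (\<nu> + 1 + of_nat k) / fact k * ?w x ^ k)) * exp (- of_real a * of_real (x powr \<xi>)))"
  obtain C where C: "C \<ge> 0" "\<And>k. norm (rGamma (\<nu> + 1 + of_nat k)) \<le> C * 2 ^ k / fact k"
    using norm_rGamma_shift_le by blast
  define G where "G = (\<lambda>x. C * exp (2 * y) * norm (indicator {0<..} x *\<^sub>R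
      (complex_of_real x powr (s - 1) * of_real (exp (- ((a - 2 * y) * x powr \<xi>))))))"
  have "(\<lambda>k. integral\<^sup>L lborel (f k)) sums hankel_Laplace s \<nu> y \<xi> (of_real a)"
    unfolding hankel_Laplace_def
  proof (rule integral_sums_dominated)
    show "f k \<in> borel_measurable lborel" for k unfolding f_def by measurable
    show "(\<lambda>k. f k x) sums (hankel_kernel s \<nu> y x * exp (- of_real a * of_real (x powr \<xi>)))" for x
      unfolding f_def hankel_kernel_def
      by (intro sums_mult2 sums_scaleR_right sums_mult bessel_clifford_sums)
    show "integrable lborel G"
      unfolding G_def
      using set_integrable_powr_exp_powr[OF s, of "a - 2 * y" \<xi>] a \<xi>
      by (intro integrable_mult_right integrable_norm) (simp add: set_integrable_def)
    fix x :: real and N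
    show "(\<Sum>k<N. norm (f k x)) \<le> G x"
    proof (cases "x > 0")
      case x: True
      define E where "E = norm (complex_of_real x powr (s - 1)) * exp (- (a * x powr \<xi>))"
      define t where "t = x * y"
      have t: "t \<ge> 0" using x y by (simp add: t_def)
      have E: "E \<ge> 0" by (simp add: E_def)
      have term_le: "norm (f k x) \<le> E * C * (t ^ k / fact k) ^ 2" for k
      proof -
        have "norm (f k x) = E * (norm (rGamma (\<nu> + 1 + of_nat k)) * ((t ^ 2 / 4) ^ k / fact k))"
          using x y by (simp add: f_def E_def t_def norm_mult norm_divide norm_power)
        also have "\<dots> \<le> E * (C * 2 ^ k / fact k * ((t ^ 2 / 4) ^ k / fact k))"
          by (intro mult_left_mono mult_right_mono C E) auto
        also have "\<dots> = E * C * ((2 * (t ^ 2 / 4)) ^ k / (fact k) ^ 2)"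
          unfolding power_mult_distrib by (simp add: power2_eq_square)
        also have "\<dots> \<le> E * C * ((t ^ 2) ^ k / (fact k) ^ 2)"
          using E C(1) by (intro mult_left_mono divide_right_mono power_mono) auto
        also have "\<dots> = E * C * (t ^ k / fact k) ^ 2"
          by (simp add: power_divide flip: power_mult) (simp add: mult.commute)
        finally show ?thesis .
      qed
      have "(\<Sum>k<N. norm (f k x)) \<le> (\<Sum>k<N. E * C * (t ^ k / fact k) ^ 2)"
        by (intro sum_mono term_le)
      also have "\<dots> \<le> E * C * (\<Sum>k<N. t ^ k / fact k) ^ 2"
        unfolding sum_distrib_left[symmetric]
        using E C(1) t by (intro mult_left_mono sum_squares_le_square_sum) auto
      also have "\<dots> \<le> E * C * exp t ^ 2"
        using E C(1) t by (intro mult_left_mono power_mono sum_exp_series_le sum_nonneg) auto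
      also have "exp t ^ 2 = exp (2 * x * y)" by (simp add: t_def mult_ac flip: exp_double)
      also have "\<dots> \<le> exp (2 * y + 2 * y * x powr \<xi>)"
      proof -
        have "x \<le> 1 + x powr \<xi>"
        proof (cases "x \<le> 1")
          case False
          hence "x powr 1 \<le> x powr \<xi>" using \<xi> by (intro powr_mono) auto
          thus ?thesis using x by simp
        qed (simp add: add_increasing2)
        hence "2 * y * x \<le> 2 * y * (1 + x powr \<xi>)" using y by (intro mult_left_mono) auto
        thus ?thesis by (simp add: algebra_simps)
      qed
      also have "E * C * exp (2 * y + 2 * y * x powr \<xi>) = G x"
        using x by (simp add: E_def G_def norm_mult exp_add algebra_simps exp_diff exp_minus divide_inverse norm_inverse)
      finally show ?thesis using E C(1) by (simp add: mult_left_mono)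
    qed (simp add: f_def G_def)
  qed
  moreover have "integral\<^sup>L lborel (f k) = of_real a powr (- (s / of_real \<xi>)) / of_real \<xi> *
      fox_wright_term [(s / of_real \<xi>, 2 / \<xi>)] [(\<nu> + 1, 1)]
        (- (of_real y ^ 2 / (4 * of_real a powr of_real (2 / \<xi>)))) k" for k
  proof -
    define c where "c = rGamma (\<nu> + 1 + of_nat k) / fact k * (- (complex_of_real y ^ 2 / 4)) ^ k"
    have a0: "a > 0" using a y by simp
    have "f k x = c * (indicator {0<..} x *\<^sub>R (of_real x powr (s + of_nat (2 * k) - 1) *
        of_real (exp (- (a * x powr \<xi>)))))" for x
    proof (cases "x > 0")
      case x: True
      have "complex_of_real x powr (s + of_nat (2 * k) - 1) = of_real x powr (s - 1) * of_real x ^ (2 * k)"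
      proof -
        have "s + of_nat (2 * k) - 1 = (s - 1) + of_nat (2 * k)" by simp
        moreover have "complex_of_real x powr of_nat (2 * k) = of_real x ^ (2 * k)"
          using x by (intro powr_nat') auto
        ultimately show ?thesis by (simp only: powr_add)
      qed
      moreover have "?w x ^ k = (- (complex_of_real y ^ 2 / 4)) ^ k * of_real x ^ (2 * k)"
        by (simp add: power_mult flip: power_mult_distrib) (simp add: power_mult_distrib mult.commute)
      moreover have "exp (- complex_of_real a * of_real (x powr \<xi>)) = of_real (exp (- (a * x powr \<xi>)))"
        by (simp flip: exp_of_real)
      ultimately show ?thesis using x by (simp add: f_def c_def mult_ac)
    qed (simp add: f_def)
    hence "f k = (\<lambda>x. c * (indicator {0<..} x *\<^sub>R (of_real x powr (s + of_nat (2 * k) - 1) *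
        of_real (exp (- (a * x powr \<xi>))))))" by (rule ext)
    hence "integral\<^sup>L lborel (f k) = c * (LINT x:{0<..}|lborel. of_real x powr (s + of_nat (2 * k) - 1) *
        of_real (exp (- (a * x powr \<xi>))))"
      by (simp only: set_lebesgue_integral_def integral_mult_right_zero)
    also have "\<dots> = c * (Gamma ((s + of_nat (2 * k)) / of_real \<xi>) *
        of_real a powr (- ((s + of_nat (2 * k)) / of_real \<xi>)) / of_real \<xi>)"
      using s \<xi> a0 by (subst set_integral_powr_exp_powr) auto
    finally have int: "integral\<^sup>L lborel (f k) = c * (Gamma ((s + of_nat (2 * k)) / of_real \<xi>) *
        of_real a powr (- ((s + of_nat (2 * k)) / of_real \<xi>)) / of_real \<xi>)" .
    have shift: "(s + of_nat (2 * k)) / of_real \<xi> = s / of_real \<xi> + of_nat k * of_real (2 / \<xi>)"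
      by (simp add: add_divide_distrib)
    have "(of_real a powr of_real (2 / \<xi>)) ^ k = complex_of_real a powr (of_nat k * of_real (2 / \<xi>))"
      by (simp only: powr_of_real_pos[OF a0] mult.assoc exp_of_nat_mult)
    hence pow: "of_real a powr (- (s / of_real \<xi> + of_nat k * of_real (2 / \<xi>))) =
        of_real a powr (- (s / of_real \<xi>)) / (of_real a powr of_real (2 / \<xi>)) ^ k"
      by (simp only: minus_add_distrib powr_add powr_minus divide_inverse)
    have c: "c = (- (complex_of_real y ^ 2 / 4)) ^ k / (Gamma (\<nu> + 1 + of_nat k) * fact k)"
      unfolding c_def rGamma_inverse_Gamma
      by (simp only: divide_inverse inverse_mult_distrib mult_ac)
    have "- (complex_of_real y ^ 2 / (4 * p)) = - (complex_of_real y ^ 2 / 4) / p" for p by simp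
    hence z: "(- (of_real y ^ 2 / (4 * of_real a powr of_real (2 / \<xi>)))) ^ k =
       (- (complex_of_real y ^ 2 / 4)) ^ k / (of_real a powr of_real (2 / \<xi>)) ^ k"
      by (simp only: power_divide)
    show ?thesis
      unfolding int shift pow c fox_wright_term_1_1 z
      by (simp only: divide_inverse inverse_mult_distrib mult_ac)
  qed
  ultimately show ?thesis by simp
qed

section \<open>The Fox--Wright formula for a single integral\<close>

text \<open>
  The logarithmic variable \<open>w = Ln a\<close> makes all powers of \<open>a\<close> exponentials in \<open>w\<close>. The region where \<open>\<bar>a\<bar>\<close>
  exceeds its given value becomes the half-strip \<open>S\<close>, which is convex and hence connected, and on
  which the argument \<open>Z w\<close> of the series has strictly smaller modulus than at the given point \<open>w0\<close>. So both sides
  are holomorphic on \<open>S\<close> and agree far out on the real axis. As \<open>w0\<close> itself is only a boundary point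
  of \<open>S\<close>, it is approached horizontally, which moves \<open>Z\<close> radially as in Abel's theorem.
\<close>

lemma hankel_Laplace_eq_fox_wright:
  assumes s: "Re s > 0" and \<xi>: "\<xi> > 0" and y: "y > 0" and a: "Re a > 0" and \<nu>: "\<nu> + 1 \<notin> \<int>\<^sub>\<le>\<^sub>0"
    and summable: "summable (fox_wright_term [(s / of_real \<xi>, 2 / \<xi>)] [(\<nu> + 1, 1)]
        (- (of_real y ^ 2 / (4 * a powr of_real (2 / \<xi>)))))"
  shows "hankel_Laplace s \<nu> y \<xi> a = a powr (- (s / of_real \<xi>)) / of_real \<xi> *
      fox_wright [(s / of_real \<xi>, 2 / \<xi>)] [(\<nu> + 1, 1)]
        (- (of_real y ^ 2 / (4 * a powr of_real (2 / \<xi>))))"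
proof -
  define \<sigma> where "\<sigma> = s / of_real \<xi>"
  define \<tau> where "\<tau> = 2 / \<xi>"
  have \<tau>: "\<tau> > 0" using \<xi> by (simp add: \<tau>_def)
  define c where "c = (\<lambda>k. fox_wright_term [(\<sigma>, \<tau>)] [(\<nu> + 1, 1)] 1 k)"
  have term_eq: "fox_wright_term [(\<sigma>, \<tau>)] [(\<nu> + 1, 1)] z = (\<lambda>k. c k * z ^ k)" for z
    by (simp add: c_def fox_wright_term_def fun_eq_iff)
  define \<Psi> where "\<Psi> = (\<lambda>z. \<Sum>k. c k * z ^ k)"
  have fw: "fox_wright [(\<sigma>, \<tau>)] [(\<nu> + 1, 1)] = \<Psi>"
    by (simp add: fun_eq_iff fox_wright_def \<Psi>_def term_eq)
  define w0 where "w0 = Ln a"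
  have a0: "a \<noteq> 0" using a by auto
  have neg_div: "- (complex_of_real y ^ 2 / (4 * p)) = - (of_real y ^ 2 / 4) * inverse p" for p
    by (simp only: divide_inverse inverse_mult_distrib mult.assoc mult_minus_left)
  have Z: "- (of_real y ^ 2 / (4 * exp w powr of_real \<tau>)) = - (of_real y ^ 2 / 4) * exp (- of_real \<tau> * w)"
    if "\<bar>Im w\<bar> < pi" for w :: complex
  proof -
    have "exp w powr of_real \<tau> = exp (of_real \<tau> * w)"
      using that by (simp add: powr_def Ln_exp)
    thus ?thesis by (simp only: neg_div mult_minus_left exp_minus)
  qed
  define Z where "Z = (\<lambda>w :: complex. - (of_real y ^ 2 / 4) * exp (- of_real \<tau> * w))"
  have exp_w0: "exp w0 = a" using a0 by (simp add: w0_def)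
  have Im_w0: "\<bar>Im w0\<bar> < pi / 2"
    unfolding w0_def using a Re_Ln_pos_lt[OF a0] by auto
  have z0: "- (of_real y ^ 2 / (4 * a powr of_real \<tau>)) = Z w0"
    using Z[of w0] Im_w0 exp_w0 by (simp add: Z_def)
  have sm0: "summable (\<lambda>k. c k * Z w0 ^ k)"
    using summable unfolding \<sigma>_def[symmetric] \<tau>_def[symmetric] z0 term_eq .
  have Z_nz: "Z w \<noteq> 0" for w using y by (simp add: Z_def)

  have \<xi>1: "\<xi> \<ge> 1"
  proof (rule ccontr)
    assume "\<not> \<xi> \<ge> 1"
    hence "\<tau> > 2" using \<xi> by (simp add: \<tau>_def field_simps)
    moreover have "Re \<sigma> > 0" using s \<xi> by (simp add: \<sigma>_def)
    ultimately have "\<not> summable (fox_wright_term [(\<sigma>, \<tau>)] [(\<nu> + 1, 1)] (Z w0))"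
      using \<nu> Z_nz by (intro not_summable_fox_wright_term)
    with sm0 show False by (simp add: term_eq)
  qed

  define S where "S = {w. Re w > Re w0} \<inter> {w. \<bar>Im w\<bar> < pi / 2}"
  define H where "H = (\<lambda>w. hankel_Laplace s \<nu> y \<xi> (exp w))"
  define T where "T = (\<lambda>w. exp (- \<sigma> * w) / of_real \<xi> * \<Psi> (Z w))"
  have S_alt: "S = {w. Re w > Re w0} \<inter> {w. Im w < pi / 2} \<inter> {w. Im w > - (pi / 2)}"
    unfolding S_def by auto
  have S: "open S" "connected S"
    unfolding S_alt
    by (intro open_Int open_halfspace_Re_gt open_halfspace_Im_lt open_halfspace_Im_gt)
       (intro convex_connected convex_Int convex_halfspace_Re_gt convex_halfspace_Im_lt convex_halfspace_Im_gt)
  have Re_exp_pos: "Re (exp w) > 0" if "\<bar>Im w\<bar> < pi / 2" for w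
    using that cos_gt_zero_pi[of "Im w"] by (simp add: Re_exp)
  have hol_H': "H holomorphic_on {w. \<bar>Im w\<bar> < pi / 2}"
    unfolding H_def
    by (rule holomorphic_on_compose_gen[OF holomorphic_on_exp holomorphic_hankel_Laplace[OF s \<xi> y], unfolded o_def])
       (use Re_exp_pos in auto)
  have norm_Z: "norm (Z w) = y ^ 2 / 4 * exp (- \<tau> * Re w)" for w
    using y by (simp add: Z_def norm_mult norm_divide norm_power norm_exp_eq_Re)
  have Z_ball: "Z ` S \<subseteq> ball 0 (norm (Z w0))"
    using y \<tau> by (auto simp: S_def norm_Z)
  have hol_\<Psi>: "\<Psi> holomorphic_on ball 0 (norm (Z w0))"
  proof (rule power_series_holomorphic)
    fix w :: complex assume "w \<in> ball 0 (norm (Z w0))"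
    hence "summable (\<lambda>k. c k * w ^ k)" using powser_inside[OF sm0, of w] by simp
    thus "(\<lambda>k. c k * (w - 0) ^ k) sums \<Psi> w" by (simp add: \<Psi>_def summable_sums)
  qed
  have "(\<lambda>w. \<Psi> (Z w)) holomorphic_on S"
    by (rule holomorphic_on_compose_gen[OF _ hol_\<Psi> Z_ball, unfolded o_def])
       (auto simp: Z_def intro!: holomorphic_intros)
  hence hol_T: "T holomorphic_on S"
    unfolding T_def by (intro holomorphic_intros) (use \<xi> in auto)
  have hol_H: "H holomorphic_on S"
    by (rule holomorphic_on_subset[OF hol_H']) (auto simp: S_def)

  define L where "L = max (Re w0) (ln (2 * y))"
  have real: "H (of_real t) = T (of_real t)" if t: "t > L" for t
  proof -
    have "ln (2 * y) < t" using t by (simp add: L_def)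
    hence "exp (ln (2 * y)) < exp t" by simp
    hence e: "exp t > 2 * y" using y by simp
    have pw: "complex_of_real (exp t) powr z = exp (of_real t * z)" for z
      by (simp add: powr_of_real_pos mult.commute)
    have "- (of_real y ^ 2 / (4 * complex_of_real (exp t) powr of_real (2 / \<xi>))) = Z (of_real t)"
      by (simp only: pw neg_div Z_def \<tau>_def mult_minus_left exp_minus mult.commute[of "of_real t"])
    with hankel_Laplace_real_sums[OF s \<xi>1 y e, of \<nu>]
    have "(\<lambda>k. of_real (exp t) powr (- \<sigma>) / of_real \<xi> * (c k * Z (of_real t) ^ k)) sums H (of_real t)"
      by (simp only: term_eq H_def exp_of_real \<sigma>_def[symmetric] \<tau>_def[symmetric])
    moreover have "summable (\<lambda>k. c k * Z (of_real t) ^ k)"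
      by (rule powser_inside[OF sm0]) (use t y \<tau> in \<open>simp add: norm_Z L_def\<close>)
    hence "(\<lambda>k. of_real (exp t) powr (- \<sigma>) / of_real \<xi> * (c k * Z (of_real t) ^ k)) sums
        (of_real (exp t) powr (- \<sigma>) / of_real \<xi> * \<Psi> (Z (of_real t)))"
      unfolding \<Psi>_def by (intro sums_mult summable_sums)
    ultimately have "H (of_real t) = of_real (exp t) powr (- \<sigma>) / of_real \<xi> * \<Psi> (Z (of_real t))"
      by (rule sums_unique2)
    thus ?thesis by (simp only: T_def pw mult.commute[of "of_real t"])
  qed

  have HT: "H w = T w" if w: "w \<in> S" for w
  proof -
    define p where "p = complex_of_real (L + 1)"
    have "p islimpt (of_real ` {L<..})"
    proof (rule islimptI)
      fix U assume "p \<in> U" "open U"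
      then obtain e where e: "e > 0" "ball p e \<subseteq> U" by (auto simp: open_contains_ball)
      define q where "q = complex_of_real (L + 1 + e / 2)"
      have "q \<in> ball p e" using e by (simp add: p_def q_def dist_norm)
      moreover have "q \<in> of_real ` {L<..}" unfolding q_def by (rule imageI) (use e in simp)
      moreover have "q \<noteq> p" using e unfolding p_def q_def of_real_eq_iff by simp
      ultimately show "\<exists>q\<in>of_real ` {L<..}. q \<in> U \<and> q \<noteq> p" using e by blast
    qed
    moreover have "of_real ` {L<..} \<subseteq> S" by (auto simp: S_def L_def)
    moreover have "p \<in> S" by (auto simp: S_def L_def p_def)
    moreover have "(\<lambda>w. H w - T w) holomorphic_on S" by (intro holomorphic_on_diff hol_H hol_T)
    moreover have "H z - T z = 0" if "z \<in> of_real ` {L<..}" for z using that real by auto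
    ultimately have "H w - T w = 0"
      using S w analytic_continuation[of "\<lambda>w. H w - T w" S "of_real ` {L<..}" p w] by blast
    thus ?thesis by simp
  qed

  have lim_t: "((\<lambda>q. - ln q / \<tau>) \<longlongrightarrow> 0) (at_left (1 :: real))"
  proof -
    have "((\<lambda>q. - ln q / \<tau>) \<longlongrightarrow> - ln 1 / \<tau>) (at_left (1 :: real))"
      using \<tau> by (intro tendsto_intros) auto
    thus ?thesis by simp
  qed
  (* The shift is chosen so that Z (\<gamma> q) is exactly Z w0 multiplied by q. *)
  define \<gamma> where "\<gamma> = (\<lambda>q. w0 + of_real (- ln q / \<tau>))"
  have \<gamma>: "(\<gamma> \<longlongrightarrow> w0) (at_left 1)"
    unfolding \<gamma>_def using tendsto_add[OF tendsto_const[of w0] tendsto_of_real[OF lim_t, where ?'a = complex]] by simp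
  have ev: "eventually (\<lambda>q. q \<in> {0<..<1}) (at_left (1 :: real))"
    by (rule eventually_at_left_real) auto
  have "isCont H w0"
  proof -
    have "open {w. \<bar>Im w\<bar> < pi / 2}"
    proof -
      have "{w. \<bar>Im w\<bar> < pi / 2} = {w. Im w < pi / 2} \<inter> {w. Im w > - (pi / 2)}" by auto
      thus ?thesis by (simp only: open_Int open_halfspace_Im_lt open_halfspace_Im_gt)
    qed
    thus ?thesis
      using holomorphic_on_imp_continuous_on[OF hol_H'] Im_w0 by (simp add: continuous_on_eq_continuous_at)
  qed
  hence limH: "((\<lambda>q. H (\<gamma> q)) \<longlongrightarrow> H w0) (at_left 1)"
    by (rule isCont_tendsto_compose[OF _ \<gamma>])
  have lim\<Psi>: "((\<lambda>q. \<Sum>k. (c k * Z w0 ^ k) * of_real q ^ k) \<longlongrightarrow> \<Psi> (Z w0)) (at_left (1 :: real))"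
    unfolding \<Psi>_def by (rule Abel_limit[OF sm0])
  have limT: "((\<lambda>q. exp (- \<sigma> * \<gamma> q) / of_real \<xi> * (\<Sum>k. (c k * Z w0 ^ k) * of_real q ^ k)) \<longlongrightarrow> T w0) (at_left (1 :: real))"
    unfolding T_def using \<xi> 
    by (intro tendsto_mult tendsto_divide tendsto_exp tendsto_const \<gamma> lim\<Psi>) auto
  have "eventually (\<lambda>q. exp (- \<sigma> * \<gamma> q) / of_real \<xi> * (\<Sum>k. (c k * Z w0 ^ k) * of_real q ^ k) = H (\<gamma> q))
      (at_left (1 :: real))"
    using ev
  proof eventually_elim
    case (elim q)
    have "- ln q / \<tau> > 0" using elim \<tau> by (intro divide_pos_pos) auto
    hence "\<gamma> q \<in> S" using Im_w0 by (simp add: S_def \<gamma>_def)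
    moreover have Z\<gamma>: "Z (\<gamma> q) = Z w0 * of_real q"
    proof -
      have "- of_real \<tau> * \<gamma> q = - of_real \<tau> * w0 + of_real (ln q)"
        using \<tau> by (simp add: \<gamma>_def algebra_simps)
      hence "exp (- of_real \<tau> * \<gamma> q) = exp (- of_real \<tau> * w0) * of_real q"
        using elim by (simp only: exp_add exp_of_real) simp
      thus ?thesis by (simp add: Z_def)
    qed
    ultimately show ?case
      by (simp only: HT T_def \<Psi>_def power_mult_distrib mult.assoc)
  qed
  from Lim_transform_eventually[OF limT this] limH have "T w0 = H w0"
    by (rule tendsto_unique[rotated]) simp
  hence "H w0 = exp (- \<sigma> * w0) / of_real \<xi> * \<Psi> (Z w0)" by (simp add: T_def)
  also have "exp (- \<sigma> * w0) = a powr (- \<sigma>)" using a0 by (simp add: powr_def w0_def)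
  finally show ?thesis
    unfolding \<sigma>_def[symmetric] \<tau>_def[symmetric] z0 fw by (simp add: H_def exp_w0)
qed

section \<open>Summation over the parameter\<close>

text \<open>
  The arguments of \<open>b\<close> and \<open>a\<close> lie in \<open>(- pi / 2, pi / 2)\<close>, so their difference stays in the range of
  the principal argument.
\<close>

lemma powr_divide_right_half_plane:
  assumes "Re b > 0" "Re a > 0"
  shows "(b / a) powr \<sigma> = b powr \<sigma> * a powr (- \<sigma>)"
proof -
  have nz: "b \<noteq> 0" "a \<noteq> 0" using assms by auto
  have "\<bar>Im (Ln b)\<bar> < pi / 2" "\<bar>Im (Ln a)\<bar> < pi / 2"
    using assms nz Re_Ln_pos_lt by auto
  hence "Ln (exp (Ln b - Ln a)) = Ln b - Ln a" by (intro Ln_exp) auto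
  moreover have "exp (Ln b - Ln a) = b / a" using nz by (simp add: exp_diff)
  ultimately have Ln_quotient: "Ln (b / a) = Ln b - Ln a" by simp
  show ?thesis
    using nz by (simp add: powr_def Ln_quotient right_diff_distrib flip: exp_add)
qed

lemma pochhammer_quotient:
  fixes a :: complex
  assumes "\<And>j. a + of_nat j \<noteq> 0"
  shows "pochhammer a k / pochhammer (1 + a) k = a / (a + of_nat k)"
proof -
  have "pochhammer (a + 1) k \<noteq> 0"
  proof
    assume "pochhammer (a + 1) k = 0"
    then obtain j where "a + 1 = - of_nat j" by (auto simp: pochhammer_eq_0_iff)
    hence "(a + 1) + of_nat j = 0" by simp
    hence "a + of_nat (Suc j) = 0" by (simp only: of_nat_Suc add.assoc)
    with assms show False by blast
  qed
  moreover have "pochhammer a k * (a + of_nat k) = a * pochhammer (a + 1) k"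
    using pochhammer_rec[of a k] pochhammer_Suc[of a k] by simp
  ultimately show ?thesis using assms[of k] by (simp add: frac_eq_eq add.commute mult.commute)
qed

lemma hankel_integrand_eq:
  assumes x: "x > 0" and y: "y > 0"
  shows "of_real x powr \<mu> * E * of_real (sqrt (x * y)) * bessel_J \<nu> (of_real (x * y)) =
    of_real y powr (\<nu> + 1 / 2) / 2 powr \<nu> * (hankel_kernel (\<mu> + \<nu> + 3 / 2) \<nu> y x * E)"
proof -
  have sq: "complex_of_real (sqrt (x * y)) = of_real (x * y) powr (1 / 2)"
    using x y powr_of_real[of "x * y" "1 / 2"] by (simp add: powr_half_sqrt)
  have half: "complex_of_real (x * y) / 2 = of_real (x * y / 2)" by simp
  have two: "(2 :: complex) powr \<nu> = of_real 2 powr \<nu>" by simp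
  have "of_real x powr \<mu> * of_real (sqrt (x * y)) * (complex_of_real (x * y) / 2) powr \<nu> =
      of_real y powr (\<nu> + 1 / 2) / 2 powr \<nu> * of_real x powr (\<mu> + \<nu> + 3 / 2 - 1)"
  proof -
    have pos: "x * y > 0" "x * y / 2 > 0" "(2 :: real) > 0" using x y by auto
    have ln: "complex_of_real (ln (x * y)) = of_real (ln x) + of_real (ln y)"
        "complex_of_real (ln (x * y / 2)) = of_real (ln x) + of_real (ln y) - of_real (ln 2)"
      using x y by (simp_all add: ln_mult ln_div)
    have "\<mu> * of_real (ln x) + 1 / 2 * (of_real (ln x) + of_real (ln y)) + \<nu> * (of_real (ln x) + of_real (ln y) - of_real (ln 2)) =
        (\<nu> + 1 / 2) * of_real (ln y) - \<nu> * of_real (ln 2) + (\<mu> + \<nu> + 3 / 2 - 1) * of_real (ln x)"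
      by (simp add: field_simps)
    thus ?thesis
      unfolding sq half two powr_of_real_pos[OF x] powr_of_real_pos[OF y] powr_of_real_pos[OF pos(1)]
        powr_of_real_pos[OF pos(2)] powr_of_real_pos[OF pos(3)] ln exp_add[symmetric] exp_diff[symmetric]
      by (rule arg_cong)
  qed
  note base = this
  have "of_real x powr \<mu> * E * of_real (sqrt (x * y)) * bessel_J \<nu> (of_real (x * y)) =
     (of_real x powr \<mu> * of_real (sqrt (x * y)) * (complex_of_real (x * y) / 2) powr \<nu>) *
     (bessel_clifford \<nu> (- (of_real (x * y) ^ 2 / 4)) * E)"
    unfolding bessel_J_eq_bessel_clifford by (simp only: mult_ac)
  also have "\<dots> = of_real y powr (\<nu> + 1 / 2) / 2 powr \<nu> * (hankel_kernel (\<mu> + \<nu> + 3 / 2) \<nu> y x * E)"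
    unfolding base using x by (simp add: hankel_kernel_def)
  finally show ?thesis .
qed

theorem theorem2:
  fixes \<Theta> :: "nat \<Rightarrow> complex" and \<mu> \<nu> \<sigma> b c :: complex and \<xi> y :: real
  assumes "bounded (range \<Theta>)"
    and "\<sigma> = (2 * \<mu> + 2 * \<nu> + 3) / (2 * of_real \<xi>)"
    and "\<xi> > 0" and "Re b > 0"
    and "Re c \<ge> 0" and "c \<noteq> 0" and "y > 0"
    and "Re (\<mu> + \<nu>) > - 3 / 2"
    and "\<nu> + 1 \<notin> \<int>\<^sub>\<le>\<^sub>0"
    and "\<And>k. summable (fox_wright_term [(\<sigma>, 2 / \<xi>)] [(\<nu> + 1, 1)]
               (- (of_real y ^ 2 / (4 * (b + c * of_nat k) powr of_real (2 / \<xi>)))))"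
  shows "(\<forall>k. set_integrable lborel {0<..} (\<lambda>x. of_real x powr \<mu> *
               exp (- (b + c * of_nat k) * of_real (x powr \<xi>)) *
               of_real (sqrt (x * y)) * bessel_J \<nu> (of_real (x * y)))) \<and>
         summable (\<lambda>k. \<Theta> k / fact k *
           (LINT x:{0<..}|lborel. of_real x powr \<mu> *
               exp (- (b + c * of_nat k) * of_real (x powr \<xi>)) *
               of_real (sqrt (x * y)) * bessel_J \<nu> (of_real (x * y)))) \<and>
         summable (\<lambda>k. \<Theta> k / fact k *
           (pochhammer (b / c) k / pochhammer (1 + b / c) k) powr \<sigma> *
           fox_wright [(\<sigma>, 2 / \<xi>)] [(\<nu> + 1, 1)]
             (- (of_real y ^ 2 / (4 * (b + c * of_nat k) powr of_real (2 / \<xi>))))) \<and>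
         (\<Sum>k. \<Theta> k / fact k *
           (LINT x:{0<..}|lborel. of_real x powr \<mu> *
               exp (- (b + c * of_nat k) * of_real (x powr \<xi>)) *
               of_real (sqrt (x * y)) * bessel_J \<nu> (of_real (x * y)))) =
         of_real y powr (\<nu> + 1 / 2) / (2 powr \<nu> * b powr \<sigma> * of_real \<xi>) *
         (\<Sum>k. \<Theta> k / fact k *
           (pochhammer (b / c) k / pochhammer (1 + b / c) k) powr \<sigma> *
           fox_wright [(\<sigma>, 2 / \<xi>)] [(\<nu> + 1, 1)]
             (- (of_real y ^ 2 / (4 * (b + c * of_nat k) powr of_real (2 / \<xi>)))))"
proof -
  define s where "s = \<mu> + \<nu> + 3 / 2"
  define a where "a = (\<lambda>k. b + c * of_nat k)"
  define K where "K = of_real y powr (\<nu> + 1 / 2) / 2 powr \<nu>"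
  (* Both series of the claim turn out to be constant multiples of the series of D. *)
  define D where "D = (\<lambda>k. \<Theta> k / fact k * hankel_Laplace s \<nu> y \<xi> (a k))"
  define lhs where "lhs = (\<lambda>k. LINT x:{0<..}|lborel. of_real x powr \<mu> *
               exp (- (b + c * of_nat k) * of_real (x powr \<xi>)) *
               of_real (sqrt (x * y)) * bessel_J \<nu> (of_real (x * y)))"
  define rhs where "rhs = (\<lambda>k. \<Theta> k / fact k *
           (pochhammer (b / c) k / pochhammer (1 + b / c) k) powr \<sigma> *
           fox_wright [(\<sigma>, 2 / \<xi>)] [(\<nu> + 1, 1)]
             (- (of_real y ^ 2 / (4 * (b + c * of_nat k) powr of_real (2 / \<xi>)))))"
  have s: "Re s > 0" using assms(8) by (simp add: s_def)
  have \<sigma>: "\<sigma> = s / of_real \<xi>"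
    using assms(2,3) by (simp add: s_def field_simps)
  have Re_a: "Re (a k) \<ge> Re b" for k using assms(5) by (simp add: a_def)
  have Re_a_pos: "Re (a k) > 0" for k using Re_a[of k] assms(4) by linarith
  have b0: "b \<noteq> 0" using assms(4) by auto

  have integrand: "indicator {0<..} x *\<^sub>R (of_real x powr \<mu> *
               exp (- (b + c * of_nat k) * of_real (x powr \<xi>)) *
               of_real (sqrt (x * y)) * bessel_J \<nu> (of_real (x * y))) =
      K * (hankel_kernel s \<nu> y x * exp (- a k * of_real (x powr \<xi>)))" for x k
  proof (cases "x > 0")
    case True
    thus ?thesis unfolding K_def s_def a_def hankel_integrand_eq[OF True assms(7)] by simp
  qed (simp add: hankel_kernel_def)
  have int: "set_integrable lborel {0<..} (\<lambda>x. of_real x powr \<mu> *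
               exp (- (b + c * of_nat k) * of_real (x powr \<xi>)) *
               of_real (sqrt (x * y)) * bessel_J \<nu> (of_real (x * y)))" for k
    unfolding set_integrable_def integrand
    by (intro integrable_mult_right integrable_hankel_Laplace s assms Re_a_pos)
  have "lhs k = K * hankel_Laplace s \<nu> y \<xi> (a k)" for k
    unfolding lhs_def set_lebesgue_integral_def integrand hankel_Laplace_def
    by (rule integral_mult_right_zero)
  hence lhs: "\<Theta> k / fact k * lhs k = K * D k" for k
    by (simp add: D_def)

  have rhs: "rhs k = b powr \<sigma> * of_real \<xi> * D k" for k
  proof -
    have "b / c + of_nat j = a j / c" for j
      using assms(6) by (simp add: a_def field_simps)
    hence "b / c + of_nat j \<noteq> 0" for j
      using Re_a_pos[of j] assms(6) by auto
    hence "pochhammer (b / c) k / pochhammer (1 + b / c) k = (b / c) / (b / c + of_nat k)"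
      by (rule pochhammer_quotient)
    also have "\<dots> = b / a k"
      unfolding \<open>b / c + of_nat k = a k / c\<close> using assms(6) by simp
    finally have poch: "(pochhammer (b / c) k / pochhammer (1 + b / c) k) powr \<sigma> = b powr \<sigma> * a k powr (- \<sigma>)"
      by (simp only: powr_divide_right_half_plane[OF assms(4) Re_a_pos])
    have H: "hankel_Laplace s \<nu> y \<xi> (a k) = a k powr (- \<sigma>) / of_real \<xi> *
        fox_wright [(\<sigma>, 2 / \<xi>)] [(\<nu> + 1, 1)]
        (- (of_real y ^ 2 / (4 * a k powr of_real (2 / \<xi>))))"
      unfolding \<sigma>
      by (rule hankel_Laplace_eq_fox_wright[OF s assms(3,7) Re_a_pos assms(9)])
         (use assms(10)[of k] in \<open>simp only: \<sigma> a_def\<close>)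
    have ak: "b + c * of_nat k = a k" by (simp add: a_def)
    show ?thesis
      unfolding rhs_def D_def H poch ak using assms(3) by simp
  qed

  obtain B where B: "\<And>k. norm (\<Theta> k) \<le> B"
    using assms(1) by (auto simp: bounded_iff)
  define I where "I = (LINT x|lborel. norm (hankel_kernel s \<nu> y x) * exp (- (Re b * x powr \<xi>)))"
  have "norm (D k) \<le> B * I * (inverse (fact k) * 1 ^ k)" for k
  proof -
    have "norm (D k) = norm (\<Theta> k) / fact k * norm (hankel_Laplace s \<nu> y \<xi> (a k))"
      by (simp add: D_def norm_mult norm_divide)
    also have "\<dots> = norm (\<Theta> k) * norm (hankel_Laplace s \<nu> y \<xi> (a k)) * inverse (fact k)"
      by (simp only: divide_inverse mult_ac)
    also have "\<dots> \<le> B * I * inverse (fact k)"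
      unfolding I_def
      by (intro mult_right_mono mult_mono B norm_hankel_Laplace_le s assms Re_a)
         (auto intro: order_trans[OF norm_ge_zero B])
    finally show ?thesis by simp
  qed
  moreover have "summable (\<lambda>k. B * I * (inverse (fact k) * 1 ^ k))"
    by (intro summable_mult summable_exp)
  ultimately have D: "summable D"
    by (rule summable_comparison_test'[where N = 0, rotated])

  have "suminf (\<lambda>k. \<Theta> k / fact k * lhs k) = K * suminf D"
    unfolding lhs by (rule suminf_mult[OF D])
  also have "\<dots> = of_real y powr (\<nu> + 1 / 2) / (2 powr \<nu> * b powr \<sigma> * of_real \<xi>) * suminf rhs"
    unfolding rhs suminf_mult[OF D] K_def using b0 assms(3) by simp
  finally have eq: "suminf (\<lambda>k. \<Theta> k / fact k * lhs k) =
      of_real y powr (\<nu> + 1 / 2) / (2 powr \<nu> * b powr \<sigma> * of_real \<xi>) * suminf rhs" .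
  have "summable (\<lambda>k. \<Theta> k / fact k * lhs k)" unfolding lhs by (rule summable_mult[OF D])
  moreover have "summable rhs" unfolding rhs by (rule summable_mult[OF D])
  ultimately show ?thesis using int eq unfolding lhs_def rhs_def by blast
qed

end
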